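(* Let $B_X$ be the open unit ball of a complex Banach space $X$, let $F:B_X\to\overline{\mathbb{U}}$ be a holomorphic mapping with $$F(z)=a+\sum_{s=1}^{\infty}P_s(z),\qquad z\in B_X,$$ where $P_s(z)=\frac{1}{s!}D^sF(0)(z^s)$, and let $\mu_m:B_X\to B_X$ be a Schwarz mapping having $z=0$ as a zero of order $m$. Then, for each $N,m\in\mathbb{N}$, the inequality $$|F(\mu_m(z))|^2+\sum_{k=N}^{\infty}\left|\frac{D^kF(\mu_m(z))\bigl((\mu_m(z))^k\bigr)}{k!}\right|\le 1$$ holds for all $z\in B_X$ with $\|z\|=r\le R_{4,m,N}$, where $R_{4,m,N}\in(0,1)$ is the smallest positive root of the equation $$r^{mN}-(1-r^m)^{N-1}(1+r^m)(1-2r^m)=0.$$ The number $R_{4,m,N}$ cannot be improved, that is, for given $m,N$ it cannot be replaced by any larger number so that the inequality remains valid for all such $F,\mu_m$ and $z$.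
   Context: $\mathbb{U}=\{\zeta\in\mathbb{C}:|\zeta|<1\}$ and $\overline{\mathbb{U}}$ is its closure. For a holomorphic mapping $F$ between (open subsets of) complex Banach spaces, $D^kF(z)$ denotes the $k$-th Fréchet derivative of $F$ at $z$ (a symmetric $k$-linear map), and $D^kF(z)(w^k)$ means $D^kF(z)(w,\ldots,w)$ with $w$ repeated $k$ times. Thus $P_s$ is the $s$-homogeneous polynomial in the Taylor expansion of $F$ at $0$, and $a=F(0)$. For $m\in\mathbb{N}=\{1,2,\ldots\}$, $z=0$ is a zero of order $m$ of a holomorphic mapping $\mu$ if $\mu(0)=0$, $D\mu(0)=0,\ldots,D^{m-1}\mu(0)=0$, but $D^m\mu(0)\ne0$. A Schwarz mapping $\mu:B_X\to B_X$ is a holomorphic mapping with $\mu(0)=0$. A divergent series of nonnegative terms is assigned the value $+\infty$. *)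

theory Defs
  imports "HOL-Analysis.Analysis"
begin

text \<open>Complex Banach spaces: the real Banach space structure is the underlying one.\<close>

class complex_banach = banach +
  fixes scaleC :: "complex \<Rightarrow> 'a \<Rightarrow> 'a"  (infixr "*\<^sub>C" 75)
  assumes scaleC_add_right: "c *\<^sub>C (x + y) = c *\<^sub>C x + c *\<^sub>C y"
    and scaleC_add_left: "(c + d) *\<^sub>C x = c *\<^sub>C x + d *\<^sub>C x"
    and scaleC_scaleC: "c *\<^sub>C (d *\<^sub>C x) = (c * d) *\<^sub>C x"
    and scaleC_of_real: "complex_of_real r *\<^sub>C x = r *\<^sub>R x"
    and norm_scaleC: "norm (c *\<^sub>C x) = cmod c * norm x"

instantiation complex :: complex_banach
begin

definition scaleC_complex :: "complex \<Rightarrow> complex \<Rightarrow> complex"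
  where "scaleC_complex c x = c * x"

instance
  by standard (simp_all add: scaleC_complex_def algebra_simps norm_mult scaleR_conv_of_real)

end

definition holomorphic_map :: "('a::complex_banach \<Rightarrow> 'b::complex_banach) \<Rightarrow> 'a set \<Rightarrow> bool"
  where "holomorphic_map f S \<longleftrightarrow> open S \<and>
    (\<forall>x\<in>S. \<exists>L. (f has_derivative L) (at x) \<and> (\<forall>c v. L (c *\<^sub>C v) = c *\<^sub>C L v))"

text \<open>
  \<open>higher_frechet f [v\<^sub>1, \<dots>, v\<^sub>k] x\<close> is the value \<open>D\<^sup>k f(x)(v\<^sub>1, \<dots>, v\<^sub>k)\<close> of the \<open>k\<close>-th Frechet
  derivative. Since the spaces of \<open>k\<close>-linear maps have no common type, \<open>D\<^sup>k f(x)\<close> is carried in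
  evaluated form: evaluation at fixed \<open>v\<^sub>2, \<dots>, v\<^sub>k\<close> is a bounded linear operation and hence
  commutes with differentiation, so \<open>D\<^sup>k f = D(D\<^sup>k\<^sup>-\<^sup>1 f)\<close> becomes the recursion below.
  For holomorphic maps the underlying real derivative is the complex one.
\<close>

primrec higher_frechet ::
    "('a::real_normed_vector \<Rightarrow> 'b::real_normed_vector) \<Rightarrow> 'a list \<Rightarrow> 'a \<Rightarrow> 'b"
  where
    "higher_frechet f [] = f"
  | "higher_frechet f (v # vs) = (\<lambda>x. frechet_derivative (higher_frechet f vs) (at x) v)"

definition taylor_term :: "('a::real_normed_vector \<Rightarrow> complex) \<Rightarrow> nat \<Rightarrow> 'a \<Rightarrow> 'a \<Rightarrow> complex"
  where "taylor_term F k x w = higher_frechet F (replicate k w) x / fact k"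

definition zero_of_order :: "('a::real_normed_vector \<Rightarrow> 'b::real_normed_vector) \<Rightarrow> 'a \<Rightarrow> nat \<Rightarrow> bool"
  where "zero_of_order f x m \<longleftrightarrow>
    (\<forall>j<m. \<forall>vs. length vs = j \<longrightarrow> higher_frechet f vs x = 0) \<and>
    (\<exists>vs. length vs = m \<and> higher_frechet f vs x \<noteq> 0)"

definition schwarz_mapping :: "('a::complex_banach \<Rightarrow> 'a) \<Rightarrow> bool"
  where "schwarz_mapping \<mu> \<longleftrightarrow>
    holomorphic_map \<mu> (ball 0 1) \<and> \<mu> ` ball 0 1 \<subseteq> ball 0 1 \<and> \<mu> 0 = 0"

definition unit_holomorphic :: "('a::complex_banach \<Rightarrow> complex) \<Rightarrow> bool"
  where "unit_holomorphic F \<longleftrightarrow>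
    holomorphic_map F (ball 0 1) \<and> F ` ball 0 1 \<subseteq> cball 0 1 \<and>
    (\<forall>z\<in>ball 0 1. (\<lambda>s. taylor_term F (Suc s) 0 z) sums (F z - F 0))"

text \<open>Valued in \<open>ennreal\<close>, so that a divergent series has the value \<open>\<infinity>\<close>.\<close>

definition bohr_sum :: "nat \<Rightarrow> ('a::real_normed_vector \<Rightarrow> complex) \<Rightarrow> 'a \<Rightarrow> ennreal"
  where "bohr_sum N F w =
    ennreal ((cmod (F w))\<^sup>2) + (\<Sum>k. ennreal (cmod (taylor_term F (N + k) w w)))"

definition smallest_positive_root :: "(real \<Rightarrow> real) \<Rightarrow> real \<Rightarrow> bool"
  where "smallest_positive_root p R \<longleftrightarrow>
    0 < R \<and> p R = 0 \<and> (\<forall>r. 0 < r \<and> p r = 0 \<longrightarrow> R \<le> r)"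

end

theory Submission
  imports Defs "HOL-Complex_Analysis.Complex_Analysis"
begin

text \<open>
  Along the ray through \<open>w\<close>, a holomorphic map \<open>F\<close> of the ball into the closed disc is a
  one-variable function \<open>f \<zeta> = F (\<zeta> *\<^sub>C sgn w)\<close>, and the terms \<open>D\<^sup>k F(w)(w\<^sup>k) / k!\<close> are its
  derivatives at \<open>\<rho> = norm w\<close> times \<open>\<rho>\<^sup>k / k!\<close>. Ruscheweyh's sharpening of the Schwarz-Pick lemma
  bounds the \<open>k\<close>-th one by \<open>(1 - \<bar>F w\<bar>\<^sup>2) / (1 + \<rho>) * x\<^sup>k\<close> with \<open>x = \<rho> / (1 - \<rho>)\<close>. For \<open>\<rho> < 1/2\<close> this is a
  convergent geometric majorant, and its tail from \<open>N\<close> on is at most \<open>1 - \<bar>F w\<bar>\<^sup>2\<close> as soon as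
  \<open>\<rho>\<^sup>N \<le> (1 - \<rho>)\<^sup>N\<^sup>-\<^sup>1 (1 + \<rho>) (1 - 2 \<rho>)\<close>. The difference of the two sides increases on \<open>[0, 1/2]\<close>,
  so this condition reads \<open>\<rho> \<le> t\<^sub>0\<close> with \<open>t\<^sub>0\<close> its unique zero there
  (\<open>bohr_poly_strict_mono\<close>, \<open>bohr_poly_root\<close>). With \<open>w = \<mu> z\<close>, a Schwarz lemma of order
  \<open>m\<close> gives \<open>\<rho> \<le> (norm z)\<^sup>m\<close>, which turns \<open>\<rho> \<le> t\<^sub>0\<close> into \<open>norm z \<le> R\<close> with \<open>R\<^sup>m = t\<^sub>0\<close>.

  The one-variable inputs are \<open>Schwarz_lemma_of_order\<close> and \<open>Ruscheweyh_higher_deriv_bound\<close>.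
  The latter is deduced from the coefficient estimate \<open>\<bar>c\<^sub>n\<bar> \<le> 1 - \<bar>c\<^sub>0\<bar>\<^sup>2\<close> for the function
  moved to the origin by a disc automorphism.

  In a Banach space two things have to be supplied. Vector-valued maps and extremal functions are
  reached through norming functionals, that is, through the Hahn-Banach theorem
  (\<open>complex_norming_functional\<close>). And the iterated derivatives in \<^const>\<open>higher_frechet\<close>
  carry meaning only if every intermediate map \<open>x \<mapsto> D\<^sup>k f(x)(v\<^sub>1, \<dots>, v\<^sub>k)\<close> is again
  Frechet differentiable. This is \<open>holomorphic_map_frechet_derivative\<close>; it rests on
  Cauchy estimates for difference quotients.

  For sharpness, let \<open>l\<close> be a norming functional of a unit vector \<open>u\<close>, let
  \<open>\<mu> x = (l x)\<^sup>m\<^sup>-\<^sup>1 x\<close> and \<open>F = (a - l) / (1 - a l)\<close> with \<open>0 < a < 1\<close>. At \<open>z = r u\<close> the sum is explicit,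
  and with \<open>t = r\<^sup>m\<close> its excess over \<open>1\<close>, divided by \<open>1 - a\<^sup>2\<close>, tends for \<open>a \<rightarrow> 1\<close> to a number with the
  sign of the polynomial at \<open>t\<close>. So for every \<open>r\<close> slightly larger than \<open>R\<close> some \<open>a\<close> violates the inequality.
\<close>

section \<open>Norming functionals\<close>

text \<open>
  The sublinear functionals dominated by the norm, ordered pointwise, take the place of the partially
  defined linear functionals of the usual Hahn-Banach argument: everything is defined on
  the whole space, and the minimal ones turn out to be linear.
\<close>

definition norm_sublinear :: "('a::real_normed_vector \<Rightarrow> real) \<Rightarrow> bool"
  where "norm_sublinear p \<longleftrightarrow>
    (\<forall>x y. p (x + y) \<le> p x + p y) \<and> (\<forall>t x. 0 \<le> t \<longrightarrow> p (t *\<^sub>R x) = t * p x) \<and>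
    (\<forall>x. p x \<le> norm x)"

lemma norm_sublinear_norm: "norm_sublinear norm"
  by (auto simp: norm_sublinear_def norm_triangle_ineq)

lemma norm_sublinear_zero: "norm_sublinear p \<Longrightarrow> p 0 = 0"
  unfolding norm_sublinear_def by (metis mult_zero_left order_refl scaleR_zero_left)

lemma norm_sublinear_ge_uminus:
  assumes "norm_sublinear p"
  shows "- p (- x) \<le> p x"
proof -
  have "p (x + - x) \<le> p x + p (- x)"
    using assms unfolding norm_sublinear_def by blast
  then show ?thesis
    using norm_sublinear_zero[OF assms] by simp
qed

lemma norm_sublinear_ge_minus_norm:
  assumes "norm_sublinear p"
  shows "- norm x \<le> p x"
proof -
  have "p (- x) \<le> norm (- x)"
    using assms unfolding norm_sublinear_def by blast
  then show ?thesis
    using norm_sublinear_ge_uminus[OF assms, of x] by simp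
qed

text \<open>
  For positive factors one inequality suffices, since it can be applied to the reciprocal factor
  as well.
\<close>

lemma norm_sublinear_homogeneousI:
  fixes p :: "'a::real_normed_vector \<Rightarrow> real"
  assumes le: "\<And>t x. 0 < t \<Longrightarrow> p (t *\<^sub>R x) \<le> t * p x" and zero: "p 0 = 0" and t: "0 \<le> (t::real)"
  shows "p (t *\<^sub>R x) = t * p x"
proof (cases "t = 0")
  case False
  then have t: "0 < t"
    using t by simp
  have "p ((1 / t) *\<^sub>R (t *\<^sub>R x)) \<le> (1 / t) * p (t *\<^sub>R x)"
    by (rule le) (use t in simp)
  moreover have "(1 / t) *\<^sub>R (t *\<^sub>R x) = x"
    using t by simp
  ultimately have "p x \<le> p (t *\<^sub>R x) / t"
    by simp
  then have "t * p x \<le> p (t *\<^sub>R x)"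
    using t by (simp add: field_simps)
  with le[OF t, of x] show ?thesis
    by simp
qed (simp add: zero)

text \<open>
  Subadditivity is where the chain property enters: two members can be replaced by the smaller
  of them before its own subadditivity is used.
\<close>

lemma norm_sublinear_INF_chain:
  assumes C: "C \<noteq> {}" "\<And>q. q \<in> C \<Longrightarrow> norm_sublinear q"
    and chain: "\<And>p q. \<lbrakk>p \<in> C; q \<in> C\<rbrakk> \<Longrightarrow> p \<le> q \<or> q \<le> p"
  shows "norm_sublinear (\<lambda>x. INF q\<in>C. q x)" and "\<And>q x. q \<in> C \<Longrightarrow> (INF q\<in>C. q x) \<le> q x"
proof -
  have bdd: "bdd_below ((\<lambda>q. q x) ` C)" for x
    by (rule bdd_belowI[of _ "- norm x"]) (use norm_sublinear_ge_minus_norm C in auto)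
  show le: "(INF q\<in>C. q x) \<le> q x" if "q \<in> C" for q x
    by (rule cINF_lower[OF bdd that])
  let ?u = "\<lambda>x. INF q\<in>C. q x"
  have "?u (x + y) \<le> ?u x + ?u y" for x y
  proof -
    have 1: "?u (x + y) \<le> p x + q y" if "p \<in> C" "q \<in> C" for p q
    proof -
      have "\<exists>r\<in>C. r \<le> p \<and> r \<le> q"
        using chain[OF that] that by blast
      then obtain r where r: "r \<in> C" "r \<le> p" "r \<le> q"
        by blast
      have "?u (x + y) \<le> r (x + y)"
        by (rule le[OF r(1)])
      also have "\<dots> \<le> r x + r y"
        using C(2)[OF r(1)] unfolding norm_sublinear_def by blast
      also have "\<dots> \<le> p x + q y"
        using r(2,3) by (simp add: add_mono le_fun_def)
      finally show ?thesis .
    qed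
    have "?u (x + y) - q y \<le> ?u x" if "q \<in> C" for q
      by (rule cINF_greatest[OF C(1)]) (use 1[OF _ that] in force)
    then have "?u (x + y) - ?u x \<le> ?u y"
      by (intro cINF_greatest[OF C(1)]) force
    then show ?thesis by simp
  qed
  moreover have "?u (t *\<^sub>R x) = t * ?u x" if "0 \<le> t" for t x
  proof (rule norm_sublinear_homogeneousI[of ?u, OF _ _ that])
    fix t x assume t: "0 < (t::real)"
    have "?u (t *\<^sub>R x) / t \<le> ?u x"
    proof (rule cINF_greatest[OF C(1)])
      fix q assume q: "q \<in> C"
      have "?u (t *\<^sub>R x) \<le> q (t *\<^sub>R x)"
        by (rule le[OF q])
      also have "\<dots> = t * q x"
        using C(2)[OF q] t unfolding norm_sublinear_def by auto
      finally show "?u (t *\<^sub>R x) / t \<le> q x"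
        using t by (simp add: field_simps)
    qed
    then show "?u (t *\<^sub>R x) \<le> t * ?u x"
      using t by (simp add: field_simps)
  next
    show "?u 0 = 0"
      by (subst INF_cong[OF refl, of C _ "\<lambda>_. 0"]) (use C norm_sublinear_zero in auto)
  qed
  moreover have "?u x \<le> norm x" for x
    using C le unfolding norm_sublinear_def by (meson all_not_in_conv order_trans)
  ultimately show "norm_sublinear ?u"
    unfolding norm_sublinear_def by blast
qed

lemma ex_minimal_norm_sublinear:
  assumes "norm_sublinear p0"
  obtains p where "norm_sublinear p" "p \<le> p0" "\<And>q. \<lbrakk>norm_sublinear q; q \<le> p\<rbrakk> \<Longrightarrow> q = p"
proof -
  let ?A = "{q. norm_sublinear q \<and> q \<le> p0}"
  let ?P = "\<lambda>a b::'a \<Rightarrow> real. b \<le> a"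
  have "\<exists>m\<in>?A. \<forall>a\<in>?A. ?P m a \<longrightarrow> a = m"
  proof (rule predicate_Zorn)
    show "partial_order_on ?A (relation_of ?P ?A)"
      by (rule partial_order_on_relation_ofI) auto
    fix C assume C: "C \<in> Chains (relation_of ?P ?A)"
    show "\<exists>u\<in>?A. \<forall>a\<in>C. ?P a u"
    proof (cases "C = {}")
      case True
      then show ?thesis using assms by auto
    next
      case False
      have CA: "q \<in> ?A" if "q \<in> C" for q
        using C that unfolding Chains_def relation_of_def by blast
      have chain: "p \<le> q \<or> q \<le> p" if "p \<in> C" "q \<in> C" for p q
        using C that unfolding Chains_def relation_of_def by blast
      have sub: "norm_sublinear q" if "q \<in> C" for q
        using CA[OF that] by blast
      note INF = norm_sublinear_INF_chain[OF False sub chain]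
      have "(\<lambda>x. INF q\<in>C. q x) \<le> q" if "q \<in> C" for q
        using INF(2)[OF _ _ _ that] unfolding le_fun_def by blast
      moreover have "(\<lambda>x. INF q\<in>C. q x) \<le> p0"
        using calculation False CA by (metis (no_types, lifting) all_not_in_conv mem_Collect_eq order_trans)
      ultimately show ?thesis
        using INF(1) by (intro bexI[of _ "\<lambda>x. INF q\<in>C. q x"]) auto
    qed
  qed
  then obtain m where "m \<in> ?A" "\<forall>a\<in>?A. ?P m a \<longrightarrow> a = m" ..
  then show ?thesis
    using that[of m] order_trans[of _ m p0] by auto
qed

text \<open>
  A sublinear minorant of \<open>p\<close> that measures how far \<open>p\<close> is from being additive in the direction \<open>y\<close>:
  if \<open>p\<close> is minimal, it equals \<open>p\<close>, and the member \<open>t = 1\<close> of the infimum yields \<open>p x + p y \<le> p (x + y)\<close>.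
\<close>

definition ray_reduction :: "('a::real_normed_vector \<Rightarrow> real) \<Rightarrow> 'a \<Rightarrow> 'a \<Rightarrow> real"
  where "ray_reduction p y x = (INF t\<in>{0..}. p (x + t *\<^sub>R y) - t * p y)"

lemma ray_reduction:
  assumes p: "norm_sublinear p"
  shows "norm_sublinear (ray_reduction p y)" and "ray_reduction p y \<le> p"
    and "ray_reduction p y x \<le> p (x + y) - p y"
proof -
  have sub: "p (u + v) \<le> p u + p v" for u v
    using p unfolding norm_sublinear_def by blast
  have hom: "p (t *\<^sub>R u) = t * p u" if "0 \<le> t" for t u
    using p that unfolding norm_sublinear_def by blast
  have ge: "- p (- x) \<le> p (x + t *\<^sub>R y) - t * p y" if "0 \<le> t" for t x
    using sub[of "x + t *\<^sub>R y" "- x"] hom[OF that, of y] by (simp add: algebra_simps)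
  have bdd: "bdd_below ((\<lambda>t. p (x + t *\<^sub>R y) - t * p y) ` {0..})" for x
    by (rule bdd_belowI[of _ "- p (- x)"]) (use ge in auto)
  have le: "ray_reduction p y x \<le> p (x + t *\<^sub>R y) - t * p y" if "0 \<le> t" for t x
    unfolding ray_reduction_def by (rule cINF_lower[OF bdd]) (use that in simp)
  have greatest: "c \<le> ray_reduction p y x" if "\<And>t. 0 \<le> t \<Longrightarrow> c \<le> p (x + t *\<^sub>R y) - t * p y" for c x
    unfolding ray_reduction_def by (rule cINF_greatest) (use that in auto)
  show lep: "ray_reduction p y \<le> p"
    using le[of 0] by (auto simp: le_fun_def)
  show "ray_reduction p y x \<le> p (x + y) - p y"
    using le[of 1 x] by simp
  let ?q = "ray_reduction p y"
  have "?q (u + v) \<le> ?q u + ?q v" for u v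
  proof -
    have 1: "?q (u + v) \<le> (p (u + s *\<^sub>R y) - s * p y) + (p (v + t *\<^sub>R y) - t * p y)"
      if "0 \<le> s" "0 \<le> t" for s t
      using le[of "s + t" "u + v"] that sub[of "u + s *\<^sub>R y" "v + t *\<^sub>R y"]
      by (simp add: algebra_simps)
    have "?q (u + v) - (p (v + t *\<^sub>R y) - t * p y) \<le> ?q u" if "0 \<le> t" for t
      by (rule greatest) (use 1[OF _ that] in force)
    then have "?q (u + v) - ?q u \<le> ?q v"
      by (intro greatest) force
    then show ?thesis by simp
  qed
  moreover have "?q (s *\<^sub>R u) = s * ?q u" if "0 \<le> s" for s u
  proof (rule norm_sublinear_homogeneousI[of ?q, OF _ _ that])
    fix s u assume s: "0 < (s::real)"
    have "?q (s *\<^sub>R u) / s \<le> ?q u"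
    proof (rule greatest)
      fix t :: real assume t: "0 \<le> t"
      have "?q (s *\<^sub>R u) \<le> p (s *\<^sub>R u + (s * t) *\<^sub>R y) - (s * t) * p y"
        by (rule le) (use s t in simp)
      also have "s *\<^sub>R u + (s * t) *\<^sub>R y = s *\<^sub>R (u + t *\<^sub>R y)"
        by (simp add: algebra_simps)
      finally show "?q (s *\<^sub>R u) / s \<le> p (u + t *\<^sub>R y) - t * p y"
        using s hom[of s "u + t *\<^sub>R y"] by (simp add: field_simps)
    qed
    then show "?q (s *\<^sub>R u) \<le> s * ?q u"
      using s by (simp add: field_simps)
  next
    have "- p (- 0) \<le> ?q 0"
      by (rule greatest) (rule ge)
    moreover have "?q 0 \<le> p 0"
      using lep by (simp add: le_fun_def)
    ultimately show "?q 0 = 0"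
      using norm_sublinear_zero[OF p] by simp
  qed
  moreover have "?q x \<le> norm x" for x
    using lep p unfolding norm_sublinear_def le_fun_def by (meson order_trans)
  ultimately show "norm_sublinear ?q"
    unfolding norm_sublinear_def by blast
qed

lemma minimal_norm_sublinear_linear:
  assumes p: "norm_sublinear p" and min: "\<And>q. \<lbrakk>norm_sublinear q; q \<le> p\<rbrakk> \<Longrightarrow> q = p"
  shows "linear p"
proof -
  have add: "p (x + y) = p x + p y" for x y
  proof (rule antisym)
    show "p (x + y) \<le> p x + p y"
      using p unfolding norm_sublinear_def by blast
    have "ray_reduction p y = p"
      by (rule min[OF ray_reduction(1,2)[OF p]])
    then show "p x + p y \<le> p (x + y)"
      using ray_reduction(3)[OF p, of y x] by simp
  qed
  have neg: "p (- x) = - p x" for x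
    using add[of x "- x"] norm_sublinear_zero[OF p] by simp
  have "p (t *\<^sub>R x) = t *\<^sub>R p x" for t x
  proof (cases "0 \<le> t")
    case True
    then show ?thesis
      using p unfolding norm_sublinear_def by simp
  next
    case False
    then have "p ((- t) *\<^sub>R x) = - t * p x"
      using p unfolding norm_sublinear_def by (meson less_imp_le neg_0_le_iff_le not_le)
    then show ?thesis
      using neg[of "t *\<^sub>R x"] by simp
  qed
  with add show ?thesis
    by (intro linearI) auto
qed

text \<open>
  Reducing the norm along the ray through \<open>x\<close> before passing to a minimal functional \<open>g\<close> forces
  \<open>g (- x) \<le> - norm x\<close>, so that \<open>g x\<close> is as large as the norm permits.
\<close>

theorem real_norming_functional:
  fixes x :: "'a::real_normed_vector"
  obtains g where "linear g" "\<And>v. g v \<le> norm v" "g x = norm x"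
proof -
  obtain g where g: "norm_sublinear g" "g \<le> ray_reduction norm x"
    "\<And>q. \<lbrakk>norm_sublinear q; q \<le> g\<rbrakk> \<Longrightarrow> q = g"
    using ex_minimal_norm_sublinear[OF ray_reduction(1)[OF norm_sublinear_norm]] by metis
  have lin: "linear g"
    by (rule minimal_norm_sublinear_linear[OF g(1,3)])
  have "g (- x) \<le> norm (- x + x) - norm x"
    using g(2) ray_reduction(3)[OF norm_sublinear_norm, of x "- x"]
    unfolding le_fun_def by (meson order_trans)
  then have "norm x \<le> g x"
    using linear_neg[OF lin, of x] by simp
  moreover have bound: "g v \<le> norm v" for v
    using g(1) unfolding norm_sublinear_def by blast
  ultimately show ?thesis
    using that[OF lin bound] by (simp add: antisym)
qed

text \<open>
  The unit ball of the complex dual space.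
\<close>

definition complex_functional :: "('a::complex_banach \<Rightarrow> complex) \<Rightarrow> bool"
  where "complex_functional \<phi> \<longleftrightarrow>
    linear \<phi> \<and> (\<forall>c v. \<phi> (c *\<^sub>C v) = c * \<phi> v) \<and> (\<forall>v. cmod (\<phi> v) \<le> norm v)"

lemma bounded_linear_complex_functional: "complex_functional \<phi> \<Longrightarrow> bounded_linear \<phi>"
  unfolding complex_functional_def bounded_linear_def bounded_linear_axioms_def
  by (metis mult.commute mult_1)

text \<open>
  A complex-linear functional is determined by its real part \<open>g\<close> as \<open>v \<mapsto> g v - \<i> g (\<i> v)\<close>.
\<close>

theorem complex_norming_functional:
  fixes x :: "'a::complex_banach"
  obtains \<phi> where "complex_functional \<phi>" "\<phi> x = of_real (norm x)"
proof -
  obtain g where g: "linear g" "\<And>v. g v \<le> norm v" "g x = norm x"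
    using real_norming_functional[of x] by blast
  define \<phi> where "\<phi> v = Complex (g v) (- g (\<i> *\<^sub>C v))" for v
  have ga: "g (u + v) = g u + g v" and gs: "g (r *\<^sub>R v) = r * g v" for u v r
    using linear_add[OF g(1)] linear_scale[OF g(1)] by auto
  have sR: "\<i> *\<^sub>C (r *\<^sub>R v) = r *\<^sub>R (\<i> *\<^sub>C v)" for r and v :: 'a
    by (simp flip: scaleC_of_real add: scaleC_scaleC mult.commute)
  have lin: "linear \<phi>"
    by (rule linearI) (auto simp: \<phi>_def complex_eq_iff ga gs scaleC_add_right sR)
  have gC: "g (c *\<^sub>C v) = Re c * g v + Im c * g (\<i> *\<^sub>C v)" for c v
  proof -
    have "c *\<^sub>C v = complex_of_real (Re c) *\<^sub>C v + complex_of_real (Im c) *\<^sub>C (\<i> *\<^sub>C v)"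
      by (simp add: scaleC_scaleC flip: scaleC_add_left) (metis complex_eq mult.commute)
    then show ?thesis
      by (simp add: scaleC_of_real ga gs)
  qed
  have hom: "\<phi> (c *\<^sub>C v) = c * \<phi> v" for c v
    using gC[of c v] gC[of "\<i> * c" v] by (simp add: \<phi>_def complex_eq_iff scaleC_scaleC)
  have bound: "cmod (\<phi> v) \<le> norm v" for v
  proof (cases "\<phi> v = 0")
    case False
    \<comment> \<open>Rotating \<open>v\<close> makes \<open>\<phi> v\<close> real and positive, so that only \<open>g\<close> is seen.\<close>
    define c where "c = cnj (\<phi> v) / cmod (\<phi> v)"
    have c: "cmod c = 1" "c * \<phi> v = cmod (\<phi> v)"
      using False complex_norm_square[of "\<phi> v"]
      by (auto simp: c_def norm_divide field_simps power2_eq_square)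
    have "cmod (\<phi> v) = Re (\<phi> (c *\<^sub>C v))"
      by (simp add: hom c)
    also have "\<dots> = g (c *\<^sub>C v)"
      by (simp add: \<phi>_def)
    also have "\<dots> \<le> norm (c *\<^sub>C v)"
      by (rule g(2))
    finally show ?thesis
      by (simp add: norm_scaleC c)
  qed simp
  have Re: "Re (\<phi> x) = norm x"
    by (simp add: \<phi>_def g(3))
  have "(norm x)\<^sup>2 + (Im (\<phi> x))\<^sup>2 \<le> (norm x)\<^sup>2"
    using power_mono[OF bound[of x] norm_ge_zero, of 2] by (simp add: cmod_power2 Re)
  then have "Im (\<phi> x) = 0"
    by simp
  with Re have "\<phi> x = of_real (norm x)"
    by (simp add: complex_eq_iff)
  then show ?thesis
    using that lin hom bound unfolding complex_functional_def by blast
qed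

section \<open>Complex differentiability in Banach spaces\<close>

lemma bounded_linear_scaleC_left: "bounded_linear (\<lambda>c. c *\<^sub>C (w::'a::complex_banach))"
proof (rule bounded_linear_intro[of _ "norm w"])
  show "(r *\<^sub>R c) *\<^sub>C w = r *\<^sub>R (c *\<^sub>C w)" for r c
    unfolding scaleR_conv_of_real by (simp add: scaleC_of_real flip: scaleC_scaleC)
qed (auto simp: scaleC_add_left norm_scaleC)

lemma bounded_linear_scaleC_right: "bounded_linear (\<lambda>x. c *\<^sub>C (x::'a::complex_banach))"
proof (rule bounded_linear_intro[of _ "cmod c"])
  show "c *\<^sub>C (r *\<^sub>R x) = r *\<^sub>R (c *\<^sub>C x)" for r and x :: 'a
    by (simp flip: scaleC_of_real add: scaleC_scaleC mult.commute)
qed (auto simp: scaleC_add_right norm_scaleC)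

lemma scaleC_diff_right: "c *\<^sub>C (x - y) = c *\<^sub>C x - c *\<^sub>C (y::'a::complex_banach)"
  using linear_diff[OF bounded_linear.linear[OF bounded_linear_scaleC_right]] .

lemma scaleC_scaleR_commute: "c *\<^sub>C (r *\<^sub>R x) = r *\<^sub>R (c *\<^sub>C (x::'a::complex_banach))"
  using linear_scale[OF bounded_linear.linear[OF bounded_linear_scaleC_right]] .

lemma scaleC_zero_left [simp]: "0 *\<^sub>C (x::'a::complex_banach) = 0"
  using linear_0[OF bounded_linear.linear[OF bounded_linear_scaleC_left]] .

lemma scaleC_one [simp]: "1 *\<^sub>C (x::'a::complex_banach) = x"
  using scaleC_of_real[of 1 x] by simp

lemma scaleC_zero_right [simp]: "c *\<^sub>C (0::'a::complex_banach) = 0"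
  using linear_0[OF bounded_linear.linear[OF bounded_linear_scaleC_right]] .

lemma holomorphic_mapI:
  assumes "open S"
    and "\<And>x. x \<in> S \<Longrightarrow> (f has_derivative f' x) (at x)"
    and "\<And>x c v. x \<in> S \<Longrightarrow> f' x (c *\<^sub>C v) = c *\<^sub>C f' x v"
  shows "holomorphic_map f S"
  unfolding holomorphic_map_def using assms by blast

lemma holomorphic_map_has_derivative:
  assumes "holomorphic_map f S" "x \<in> S"
  shows "(f has_derivative frechet_derivative f (at x)) (at x)"
  using assms unfolding holomorphic_map_def by (metis frechet_derivative_at)

lemma holomorphic_map_frechet_scaleC:
  assumes "holomorphic_map f S" "x \<in> S"
  shows "frechet_derivative f (at x) (c *\<^sub>C v) = c *\<^sub>C frechet_derivative f (at x) v"
  using assms unfolding holomorphic_map_def by (metis frechet_derivative_at)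

lemma holomorphic_map_open: "holomorphic_map f S \<Longrightarrow> open S"
  by (simp add: holomorphic_map_def)

lemma open_slice:
  assumes "open S"
  shows "open {\<zeta>. x + \<zeta> *\<^sub>C (w::'a::complex_banach) \<in> S}"
proof -
  have "continuous_on UNIV (\<lambda>\<zeta>. x + \<zeta> *\<^sub>C w)"
    by (intro continuous_intros bounded_linear.continuous_on[OF bounded_linear_scaleC_left])
  then show ?thesis
    using open_vimage[OF assms] by (simp add: vimage_def)
qed

text \<open>
  Complex homogeneity of the Frechet derivative makes every scalar slice holomorphic; this is how
  one-variable theory becomes available.
\<close>

lemma holomorphic_map_slice_derivative:
  assumes f: "holomorphic_map f S" and \<phi>: "complex_functional \<phi>" and x: "x + \<zeta> *\<^sub>C w \<in> S"
  shows "((\<lambda>\<zeta>. \<phi> (f (x + \<zeta> *\<^sub>C w))) has_field_derivative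
    \<phi> (frechet_derivative f (at (x + \<zeta> *\<^sub>C w)) w)) (at \<zeta>)"
proof -
  let ?D = "frechet_derivative f (at (x + \<zeta> *\<^sub>C w))"
  have "((\<lambda>\<zeta>. x + \<zeta> *\<^sub>C w) has_derivative (\<lambda>h. h *\<^sub>C w)) (at \<zeta>)"
    by (auto intro!: derivative_eq_intros
        bounded_linear.has_derivative[OF bounded_linear_scaleC_left])
  then have "((\<lambda>\<zeta>. f (x + \<zeta> *\<^sub>C w)) has_derivative (\<lambda>h. ?D (h *\<^sub>C w))) (at \<zeta>)"
    using has_derivative_compose holomorphic_map_has_derivative[OF f x] by fast
  from bounded_linear.has_derivative[OF bounded_linear_complex_functional[OF \<phi>] this]
  have "((\<lambda>\<zeta>. \<phi> (f (x + \<zeta> *\<^sub>C w))) has_derivative (\<lambda>h. \<phi> (?D (h *\<^sub>C w)))) (at \<zeta>)" .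
  also have "(\<lambda>h. \<phi> (?D (h *\<^sub>C w))) = (*) (\<phi> (?D w))"
    using \<phi> by (auto simp: holomorphic_map_frechet_scaleC[OF f x] complex_functional_def mult.commute)
  finally show ?thesis
    by (simp add: has_field_derivative_def)
qed

lemma holomorphic_slice:
  assumes "holomorphic_map f S" "complex_functional \<phi>" "\<And>\<zeta>. \<zeta> \<in> T \<Longrightarrow> x + \<zeta> *\<^sub>C w \<in> S"
  shows "(\<lambda>\<zeta>. \<phi> (f (x + \<zeta> *\<^sub>C w))) holomorphic_on T"
  unfolding holomorphic_on_def field_differentiable_def
  using holomorphic_map_slice_derivative[OF assms(1,2)] assms(3)
  by (meson has_field_derivative_at_within)

text \<open>
  Cauchy's inequality for the slice \<open>\<zeta> \<mapsto> \<phi> (f (x + \<zeta> h))\<close>, where \<open>\<phi>\<close> norms the derivative to be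
  estimated, so that nothing is lost in passing to scalars.
\<close>

lemma frechet_derivative_slice_bound:
  fixes f :: "'a::complex_banach \<Rightarrow> 'b::complex_banach"
  assumes f: "holomorphic_map f S"
    and in_S: "\<And>\<zeta>. cmod \<zeta> \<le> 1 \<Longrightarrow> x + \<zeta> *\<^sub>C h \<in> S"
    and le: "\<And>\<zeta>. cmod \<zeta> \<le> 1 \<Longrightarrow> norm (f (x + \<zeta> *\<^sub>C h)) \<le> M"
  shows "norm (frechet_derivative f (at x) h) \<le> M"
proof -
  obtain \<phi> :: "'b \<Rightarrow> complex" where \<phi>: "complex_functional \<phi>"
    and norming: "\<phi> (frechet_derivative f (at x) h) = of_real (norm (frechet_derivative f (at x) h))"
    using complex_norming_functional by blast
  let ?g = "\<lambda>\<zeta>. \<phi> (f (x + \<zeta> *\<^sub>C h))"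
  have hol: "?g holomorphic_on cball 0 1"
    by (rule holomorphic_slice[OF f \<phi>]) (use in_S in auto)
  have "cmod ((deriv ^^ 1) ?g 0) \<le> fact 1 * M / 1 ^ 1"
  proof (rule Cauchy_inequality)
    show "?g holomorphic_on ball 0 1"
      by (rule holomorphic_on_subset[OF hol]) auto
    show "continuous_on (cball 0 1) ?g"
      by (rule holomorphic_on_imp_continuous_on[OF hol])
    fix \<zeta> :: complex assume "cmod (0 - \<zeta>) = 1"
    then show "cmod (?g \<zeta>) \<le> M"
      using le[of \<zeta>] \<phi> unfolding complex_functional_def
      by (metis norm_minus_commute diff_zero order_refl order_trans)
  qed simp
  moreover have "deriv ?g 0 = \<phi> (frechet_derivative f (at x) h)"
    using holomorphic_map_slice_derivative[OF f \<phi>, of x 0 h] in_S[of 0]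
    by (intro DERIV_imp_deriv) simp
  ultimately show ?thesis
    by (simp add: norming)
qed

lemma frechet_derivative_Cauchy_estimate:
  fixes f :: "'a::complex_banach \<Rightarrow> 'b::complex_banach"
  assumes f: "holomorphic_map f S" and r: "0 < r"
    and ball: "\<And>y. dist x y \<le> r \<Longrightarrow> y \<in> S \<and> norm (f y) \<le> M"
  shows "norm (frechet_derivative f (at x) h) \<le> M / r * norm h"
proof -
  have "x \<in> S"
    using ball[of x] r by simp
  from has_derivative_linear[OF holomorphic_map_has_derivative[OF f this]]
  have lin: "linear (frechet_derivative f (at x))" .
  show ?thesis
  proof (cases "h = 0")
    case True
    then show ?thesis
      using linear_0[OF lin] by simp
  next
    case False
    let ?h = "(r / norm h) *\<^sub>R h"
    have "dist x (x + \<zeta> *\<^sub>C ?h) \<le> r" if "cmod \<zeta> \<le> 1" for \<zeta>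
      using that r False mult_right_le_one_le[of r "cmod \<zeta>"]
      by (simp add: dist_norm norm_scaleC mult.commute)
    then have "norm (frechet_derivative f (at x) ?h) \<le> M"
      using ball by (intro frechet_derivative_slice_bound[OF f]) auto
    then have "r / norm h * norm (frechet_derivative f (at x) h) \<le> M"
      using r by (simp add: linear_scale[OF lin])
    then show ?thesis
      using r False by (simp add: field_simps)
  qed
qed

text \<open>
  The factor \<open>4\<close> leaves room for the successive shrinkings of the ball below: each Cauchy
  estimate and each shift of the argument costs at most one radius \<open>r\<close>.
\<close>

lemma holomorphic_map_locally_bounded:
  assumes f: "holomorphic_map f S" and x: "x \<in> S"
  obtains r M where "0 < r" "0 < M" "ball x (4 * r) \<subseteq> S"
    "\<And>y. y \<in> ball x (4 * r) \<Longrightarrow> norm (f y) \<le> M"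
proof -
  obtain e where e: "0 < e" "ball x e \<subseteq> S"
    using holomorphic_map_open[OF f] x open_contains_ball by blast
  have "continuous (at x) f"
    by (rule has_derivative_continuous[OF holomorphic_map_has_derivative[OF f x]])
  then obtain d where d: "0 < d" "\<And>y. dist y x < d \<Longrightarrow> dist (f y) (f x) < 1"
    unfolding continuous_at_eps_delta by (metis zero_less_one)
  let ?r = "min e d / 4"
  show ?thesis
  proof (rule that[of ?r "norm (f x) + 1"])
    show "ball x (4 * ?r) \<subseteq> S"
      using e by auto
    fix y assume "y \<in> ball x (4 * ?r)"
    then have "dist (f y) (f x) < 1"
      by (intro d(2)) (auto simp: dist_commute)
    then show "norm (f y) \<le> norm (f x) + 1"
      using norm_triangle_sub[of "f y" "f x"] by (simp add: dist_norm)
  qed (use e d in \<open>auto intro: add_nonneg_pos\<close>)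
qed

lemma holomorphic_map_difference_quotient:
  assumes f: "holomorphic_map f S" and SV: "\<And>z. z \<in> V \<Longrightarrow> z \<in> S \<and> z + w \<in> S" and V: "open V"
  shows "holomorphic_map (\<lambda>z. c *\<^sub>R (f (z + w) - f z)) V"
    and "\<And>z. z \<in> V \<Longrightarrow> frechet_derivative (\<lambda>z. c *\<^sub>R (f (z + w) - f z)) (at z) =
      (\<lambda>h. c *\<^sub>R (frechet_derivative f (at (z + w)) h - frechet_derivative f (at z) h))"
proof -
  let ?q = "\<lambda>z. c *\<^sub>R (f (z + w) - f z)"
  let ?D = "\<lambda>z h. c *\<^sub>R (frechet_derivative f (at (z + w)) h - frechet_derivative f (at z) h)"
  have q: "(?q has_derivative ?D z) (at z)" if "z \<in> V" for z
  proof -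
    have "((\<lambda>z. z + w) has_derivative (\<lambda>h. h)) (at z)"
      by (auto intro!: derivative_eq_intros)
    then have "((\<lambda>z. f (z + w)) has_derivative frechet_derivative f (at (z + w))) (at z)"
      using has_derivative_compose holomorphic_map_has_derivative[OF f] SV[OF that] by fast
    then show ?thesis
      using SV[OF that]
      by (intro derivative_intros has_derivative_scaleR_right has_derivative_diff holomorphic_map_has_derivative[OF f]) auto
  qed
  show "holomorphic_map ?q V"
    by (rule holomorphic_mapI[OF V q])
      (use SV in \<open>auto simp: holomorphic_map_frechet_scaleC[OF f] scaleC_diff_right scaleC_scaleR_commute\<close>)
  show "frechet_derivative ?q (at z) = ?D z" if "z \<in> V" for z
    using frechet_derivative_at[OF q[OF that]] by simp
qed

text \<open>
  The Cauchy estimate for the difference \<open>z \<mapsto> f (z + (y - x)) - f z\<close>. This function is itself of size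
  \<open>norm (y - x)\<close>, because a first Cauchy estimate makes \<open>f\<close> Lipschitz.
\<close>

lemma frechet_derivative_locally_Lipschitz:
  fixes f :: "'a::complex_banach \<Rightarrow> 'b::complex_banach"
  assumes f: "holomorphic_map f S" and r: "0 < r" and ball: "ball x0 (4 * r) \<subseteq> S"
    and M: "\<And>y. y \<in> ball x0 (4 * r) \<Longrightarrow> norm (f y) \<le> M"
    and x: "x \<in> ball x0 (2 * r)" and y: "y \<in> ball x0 (2 * r)"
  shows "norm (frechet_derivative f (at y) h - frechet_derivative f (at x) h)
    \<le> M / r\<^sup>2 * norm (y - x) * norm h"
proof -
  have M0: "0 \<le> M"
    by (rule order_trans[OF norm_ge_zero M[of x0]]) (use r in simp)
  have D: "norm (frechet_derivative f (at z) h) \<le> M / r * norm h" if "z \<in> ball x0 (3 * r)" for z h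
  proof (rule frechet_derivative_Cauchy_estimate[OF f r])
    fix u assume "dist z u \<le> r"
    then have "u \<in> ball x0 (4 * r)"
      using that dist_triangle[of x0 u z] by auto
    then show "u \<in> S \<and> norm (f u) \<le> M"
      using ball M by auto
  qed
  have Lip: "norm (f u - f v) \<le> M / r * norm (u - v)"
    if "u \<in> ball x0 (3 * r)" "v \<in> ball x0 (3 * r)" for u v
  proof (rule differentiable_bound[OF convex_ball _ _ that])
    fix z assume z: "z \<in> ball x0 (3 * r)"
    then have "z \<in> S"
      using ball r by auto
    then show "(f has_derivative frechet_derivative f (at z)) (at z within ball x0 (3 * r))"
      by (rule has_derivative_at_withinI[OF holomorphic_map_has_derivative[OF f]])
    show "onorm (frechet_derivative f (at z)) \<le> M / r"
      by (rule onorm_bound) (use D[OF z] M0 r in auto)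
  qed
  let ?w = "y - x"
  let ?V = "ball x0 (3 * r) \<inter> ball (x0 - ?w) (3 * r)"
  have V: "z \<in> ?V \<longleftrightarrow> z \<in> ball x0 (3 * r) \<and> z + ?w \<in> ball x0 (3 * r)" for z
    by (simp add: dist_norm algebra_simps)
  have VS: "z \<in> S \<and> z + ?w \<in> S" if "z \<in> ?V" for z
    using that[unfolded V] ball r by auto
  have V_open: "open ?V"
    by (intro open_Int open_ball)
  note q = holomorphic_map_difference_quotient[where c = 1 and V = ?V and w = ?w, OF f VS V_open,
      unfolded scaleR_one]
  have near: "u \<in> ?V" if "dist x u \<le> r" for u
  proof -
    have "u \<in> ball x0 (3 * r)"
      using that x dist_triangle[of x0 u x] by auto
    moreover have "dist x0 (u + ?w) \<le> dist x0 y + dist y (u + ?w)"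
      by (rule dist_triangle)
    moreover have "dist y (u + ?w) = dist x u"
      by (simp add: dist_norm)
    ultimately show ?thesis
      unfolding V using that y by simp
  qed
  have "norm (frechet_derivative (\<lambda>z. f (z + ?w) - f z) (at x) h) \<le> (M / r * norm ?w) / r * norm h"
  proof (rule frechet_derivative_Cauchy_estimate[OF _ r])
    show "holomorphic_map (\<lambda>z. f (z + ?w) - f z) ?V"
      by (rule q(1))
    fix u assume "dist x u \<le> r"
    then have "u \<in> ?V"
      by (rule near)
    moreover from this have "norm (f (u + ?w) - f u) \<le> M / r * norm (u + ?w - u)"
      using V by (intro Lip) auto
    ultimately show "u \<in> ?V \<and> norm (f (u + ?w) - f u) \<le> M / r * norm ?w"
      by simp
  qed
  also have "frechet_derivative (\<lambda>z. f (z + ?w) - f z) (at x) h =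
      frechet_derivative f (at y) h - frechet_derivative f (at x) h"
    using fun_cong[OF q(2)[OF _ near[of x]], of h] r by simp
  finally show ?thesis
    by (simp add: power2_eq_square)
qed

lemma frechet_derivative_quadratic_remainder:
  fixes f :: "'a::complex_banach \<Rightarrow> 'b::complex_banach"
  assumes f: "holomorphic_map f S" and r: "0 < r" and ball: "ball x0 (4 * r) \<subseteq> S"
    and M: "\<And>y. y \<in> ball x0 (4 * r) \<Longrightarrow> norm (f y) \<le> M"
    and x: "x \<in> ball x0 (2 * r)" and xh: "x + h \<in> ball x0 (2 * r)"
  shows "norm (f (x + h) - f x - frechet_derivative f (at x) h) \<le> M / r\<^sup>2 * (norm h)\<^sup>2"
proof -
  let ?B = "M / r\<^sup>2 * norm h"
  have M0: "0 \<le> M"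
    by (rule order_trans[OF norm_ge_zero M[of x0]]) (use r in simp)
  have seg: "closed_segment x (x + h) \<subseteq> ball x0 (2 * r)"
    by (rule closed_segment_subset[OF x xh convex_ball])
  have "norm (f (x + h) - f x - frechet_derivative f (at x) (x + h - x)) \<le> norm (x + h - x) * ?B"
  proof (rule differentiable_bound_linearization[where S = "closed_segment x (x + h)"])
    show "x + t *\<^sub>R (x + h - x) \<in> closed_segment x (x + h)" if "t \<in> {0..1}" for t
      using that unfolding in_segment by (auto intro!: exI[of _ t] simp: algebra_simps)
    fix y assume y: "y \<in> closed_segment x (x + h)"
    have "y \<in> ball x0 (2 * r)"
      using y seg by blast
    moreover from this have "y \<in> S"
      using ball r by auto
    ultimately show "(f has_derivative frechet_derivative f (at y)) (at y within closed_segment x (x + h))"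
      by (intro has_derivative_at_withinI[OF holomorphic_map_has_derivative[OF f]])
    have "norm (y - x) \<le> norm h"
      using segment_bound(1)[OF y] by simp
    then have B: "M / r\<^sup>2 * norm (y - x) \<le> ?B"
      using M0 by (intro mult_left_mono) auto
    show "onorm (frechet_derivative f (at y) - frechet_derivative f (at x)) \<le> ?B"
    proof (rule onorm_bound)
      fix u
      have "norm (frechet_derivative f (at y) u - frechet_derivative f (at x) u)
          \<le> M / r\<^sup>2 * norm (y - x) * norm u"
        by (rule frechet_derivative_locally_Lipschitz[OF f r ball M x \<open>y \<in> ball x0 (2 * r)\<close>])
      also have "\<dots> \<le> ?B * norm u"
        by (rule mult_right_mono[OF B]) simp
      finally show "norm ((frechet_derivative f (at y) - frechet_derivative f (at x)) u) \<le> ?B * norm u"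
        by simp
    qed (use M0 in simp)
  qed simp
  then show ?thesis
    by (simp add: power2_eq_square mult_ac)
qed

text \<open>
  The difference quotients \<open>q\<^sub>n z = (f (z + t\<^sub>n v) - f z) / t\<^sub>n\<close> with \<open>t\<^sub>n \<rightarrow> 0\<close> are holomorphic and, by the
  quadratic remainder estimate, converge to \<open>z \<mapsto> D f(z) v\<close> uniformly near \<open>x\<^sub>0\<close>. The Cauchy estimate
  applied to \<open>q\<^sub>n - q\<^sub>m\<close> then makes their derivatives uniformly convergent in operator norm, so the limit is
  differentiable, and its derivative is complex homogeneous as a limit of such maps.
\<close>

lemma holomorphic_map_frechet_derivative:
  fixes f :: "'a::complex_banach \<Rightarrow> 'b::complex_banach"
  assumes f: "holomorphic_map f S"
  shows "holomorphic_map (\<lambda>x. frechet_derivative f (at x) v) S"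
  unfolding holomorphic_map_def
proof (intro conjI ballI)
  show "open S"
    by (rule holomorphic_map_open[OF f])
  fix x0 assume x0: "x0 \<in> S"
  obtain r M where r: "0 < r" and M0: "0 < M" and ball: "ball x0 (4 * r) \<subseteq> S"
    and M: "\<And>y. y \<in> ball x0 (4 * r) \<Longrightarrow> norm (f y) \<le> M"
    using holomorphic_map_locally_bounded[OF f x0] by blast
  \<comment> \<open>The steps are so short that \<open>z + t n *\<^sub>R v\<close> stays within distance \<open>r\<close> of \<open>z\<close> from the first index on.\<close>
  define t where "t n = r / (1 + norm v) / real (Suc n)" for n
  have v1: "0 < 1 + norm v"
    using norm_ge_zero[of v] by linarith
  have t: "0 < t n" "t n * norm v < r" for n
  proof -
    show "0 < t n"
      using r v1 by (simp add: t_def)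
    have "t n * norm v \<le> r / (1 + norm v) / 1 * norm v"
      unfolding t_def using r v1 by (intro mult_right_mono divide_left_mono) auto
    also have "\<dots> < r"
      using r v1 by (simp add: field_simps)
    finally show "t n * norm v < r" .
  qed
  have t0: "t \<longlonglongrightarrow> 0"
  proof -
    have "(\<lambda>n. r / (1 + norm v) * inverse (real (Suc n))) \<longlonglongrightarrow> r / (1 + norm v) * 0"
      by (intro tendsto_mult_left LIMSEQ_inverse_real_of_nat)
    then show ?thesis
      by (simp add: t_def[abs_def] divide_inverse mult_ac)
  qed
  define q where "q n z = (1 / t n) *\<^sub>R (f (z + t n *\<^sub>R v) - f z)" for n z
  define q' where "q' n z h = (1 / t n) *\<^sub>R (frechet_derivative f (at (z + t n *\<^sub>R v)) h - frechet_derivative f (at z) h)" for n z h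
  let ?V = "ball x0 r"
  have shift: "z \<in> ball x0 (2 * r) \<and> z + t n *\<^sub>R v \<in> ball x0 (2 * r)" if "z \<in> ?V" for z n
  proof -
    have "dist x0 (z + t n *\<^sub>R v) \<le> dist x0 z + dist z (z + t n *\<^sub>R v)"
      by (rule dist_triangle)
    also have "dist z (z + t n *\<^sub>R v) = t n * norm v"
      using t(1)[of n] by (simp add: dist_norm)
    finally show ?thesis
      using that t(2)[of n] r by auto
  qed
  have shift_S: "z \<in> S \<and> z + t n *\<^sub>R v \<in> S" if "z \<in> ?V" for z n
    using shift[OF that, of n] ball r by auto
  have q_hol: "holomorphic_map (q n) ?V" for n
    unfolding q_def[abs_def] by (rule holomorphic_map_difference_quotient(1)[OF f shift_S]) auto
  have q_deriv: "frechet_derivative (q n) (at z) = q' n z" if "z \<in> ?V" for n z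
    unfolding q_def[abs_def] q'_def[abs_def]
    by (rule holomorphic_map_difference_quotient(2)[OF f shift_S _ that]) auto
  have q_D: "(q n has_derivative q' n z) (at z)" if "z \<in> ?V" for n z
    using holomorphic_map_has_derivative[OF q_hol that, of n] unfolding q_deriv[OF that] .
  have q'_C: "q' n z (c *\<^sub>C h) = c *\<^sub>C q' n z h" if "z \<in> ?V" for n z c h
    using holomorphic_map_frechet_scaleC[OF q_hol that, of n c h] unfolding q_deriv[OF that] .
  define K where "K = M / r\<^sup>2 * (norm v)\<^sup>2"
  have K0: "0 \<le> K"
    using M0 by (simp add: K_def)
  have q_lim: "norm (q n z - frechet_derivative f (at z) v) \<le> K * t n" if z: "z \<in> ?V" for n z
  proof -
    have lin: "linear (frechet_derivative f (at z))"
      using shift_S[OF z] by (intro has_derivative_linear[OF holomorphic_map_has_derivative[OF f]]) auto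
    have "norm (f (z + t n *\<^sub>R v) - f z - frechet_derivative f (at z) (t n *\<^sub>R v))
        \<le> M / r\<^sup>2 * (norm (t n *\<^sub>R v))\<^sup>2"
      using shift[OF z, of n] by (intro frechet_derivative_quadratic_remainder[OF f r ball M]) auto
    also have "\<dots> = t n * (K * t n)"
      by (simp add: K_def power2_eq_square)
    also have "f (z + t n *\<^sub>R v) - f z - frechet_derivative f (at z) (t n *\<^sub>R v) =
        t n *\<^sub>R (q n z - frechet_derivative f (at z) v)"
      using t(1)[of n] by (simp add: q_def linear_scale[OF lin] scaleR_diff_right)
    finally show ?thesis
      using t(1)[of n] by simp
  qed
  have q'_diff: "norm (q' n x h - q' m x h) \<le> 2 * K / r * (t n + t m) * norm h"
    if x: "x \<in> ball x0 (r / 2)" for n m x h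
  proof -
    have xV: "x \<in> ?V"
      using x r by auto
    have D: "((\<lambda>z. q n z - q m z) has_derivative (\<lambda>h. q' n z h - q' m z h)) (at z)" if "z \<in> ?V" for z
      by (intro has_derivative_diff q_D that)
    have "norm (frechet_derivative (\<lambda>z. q n z - q m z) (at x) h) \<le> K * (t n + t m) / (r / 2) * norm h"
    proof (rule frechet_derivative_Cauchy_estimate)
      show "holomorphic_map (\<lambda>z. q n z - q m z) ?V"
      proof (rule holomorphic_mapI[OF open_ball D])
        fix z c h assume "z \<in> ?V"
        then show "q' n z (c *\<^sub>C h) - q' m z (c *\<^sub>C h) = c *\<^sub>C (q' n z h - q' m z h)"
          by (simp add: q'_C scaleC_diff_right)
      qed
      fix y assume "dist x y \<le> r / 2"
      then have y: "y \<in> ?V"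
        using x dist_triangle[of x0 y x] by auto
      have "norm (q n y - q m y) \<le> norm (q n y - frechet_derivative f (at y) v)
          + norm (q m y - frechet_derivative f (at y) v)"
        using norm_triangle_ineq4[of "q n y - frechet_derivative f (at y) v" "q m y - frechet_derivative f (at y) v"]
        by simp
      also have "\<dots> \<le> K * (t n + t m)"
        using q_lim[OF y, of n] q_lim[OF y, of m] by (simp add: algebra_simps)
      finally show "y \<in> ?V \<and> norm (q n y - q m y) \<le> K * (t n + t m)"
        using y by simp
    qed (use r in simp)
    also have "frechet_derivative (\<lambda>z. q n z - q m z) (at x) h = q' n x h - q' m x h"
      by (simp flip: frechet_derivative_at[OF D[OF xV]])
    finally show ?thesis
      by (simp add: field_simps)
  qed
  let ?W = "ball x0 (r / 2)"
  have conv: "convergent (\<lambda>n. q' n x h)" if x: "x \<in> ?W" for x h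
  proof (rule Cauchy_convergent, rule metric_CauchyI)
    fix e :: real assume e: "0 < e"
    let ?C = "2 * K / r * norm h"
    have "(\<lambda>n. ?C * t n) \<longlonglongrightarrow> ?C * 0"
      by (intro tendsto_intros t0)
    from order_tendstoD(2)[OF this, of "e / 2"] e
    obtain N where N: "\<And>n. n \<ge> N \<Longrightarrow> ?C * t n < e / 2"
      unfolding eventually_sequentially by auto
    show "\<exists>N. \<forall>m\<ge>N. \<forall>n\<ge>N. dist (q' m x h) (q' n x h) < e"
    proof (intro exI allI impI)
      fix m n assume "m \<ge> N" "n \<ge> N"
      have "dist (q' m x h) (q' n x h) \<le> ?C * t m + ?C * t n"
        using q'_diff[OF x, of m h n] by (simp add: dist_norm algebra_simps add_divide_distrib)
      then show "dist (q' m x h) (q' n x h) < e"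
        using N[OF \<open>m \<ge> N\<close>] N[OF \<open>n \<ge> N\<close>] by linarith
    qed
  qed
  define g' where "g' x h = lim (\<lambda>n. q' n x h)" for x h
  have q'_lim: "(\<lambda>n. q' n x h) \<longlonglongrightarrow> g' x h" if "x \<in> ?W" for x h
    using conv[OF that] by (simp add: g'_def convergent_LIMSEQ_iff)
  have g'_diff: "norm (q' n x h - g' x h) \<le> 2 * K / r * t n * norm h" if x: "x \<in> ?W" for n x h
  proof (rule tendsto_le)
    show "(\<lambda>m. norm (q' n x h - q' m x h)) \<longlonglongrightarrow> norm (q' n x h - g' x h)"
      by (intro tendsto_intros q'_lim[OF x])
    have "(\<lambda>m. 2 * K / r * (t n + t m) * norm h) \<longlonglongrightarrow> 2 * K / r * (t n + 0) * norm h"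
      by (intro tendsto_intros t0)
    then show "(\<lambda>m. 2 * K / r * (t n + t m) * norm h) \<longlonglongrightarrow> 2 * K / r * t n * norm h"
      by simp
  qed (use q'_diff[OF x] in auto)
  have "\<exists>g. \<forall>x\<in>?W. (\<lambda>n. q n x) \<longlonglongrightarrow> g x \<and> (g has_derivative g' x) (at x within ?W)"
  proof (rule has_derivative_sequence)
    show "(q n has_derivative q' n x) (at x within ?W)" if "x \<in> ?W" for n x
    proof -
      have "x \<in> ?V"
        using that r by auto
      then show ?thesis
        by (rule has_derivative_at_withinI[OF q_D])
    qed
    fix e :: real assume e: "0 < e"
    have "(\<lambda>n. 2 * K / r * t n) \<longlonglongrightarrow> 2 * K / r * 0"
      by (intro tendsto_intros t0)
    then have "\<forall>\<^sub>F n in sequentially. 2 * K / r * t n < e"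
      using e order_tendstoD(2)[of _ "2 * K / r * 0" _ e] by simp
    then show "\<forall>\<^sub>F n in sequentially. \<forall>x\<in>?W. \<forall>h. norm (q' n x h - g' x h) \<le> e * norm h"
    proof eventually_elim
      case (elim n)
      show ?case
      proof (intro ballI allI)
        fix x h assume "x \<in> ?W"
        then have "norm (q' n x h - g' x h) \<le> 2 * K / r * t n * norm h"
          by (rule g'_diff)
        also have "\<dots> \<le> e * norm h"
          using elim by (intro mult_right_mono) auto
        finally show "norm (q' n x h - g' x h) \<le> e * norm h" .
      qed
    qed
  next
    show "(\<lambda>n. q n x0) \<longlonglongrightarrow> frechet_derivative f (at x0) v"
    proof (rule LIM_zero_cancel, rule tendsto_norm_zero_cancel, rule tendsto_sandwich[OF _ _ tendsto_const])
      show "(\<lambda>n. K * t n) \<longlonglongrightarrow> 0"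
        using tendsto_mult_right_zero[OF t0, of K] by (simp add: mult.commute)
      show "\<forall>\<^sub>F n in sequentially. norm (q n x0 - frechet_derivative f (at x0) v) \<le> K * t n"
        using q_lim[of x0] r by simp
    qed simp
  qed (use r in auto)
  then obtain g where g: "\<And>x. x \<in> ?W \<Longrightarrow> (\<lambda>n. q n x) \<longlonglongrightarrow> g x"
    "\<And>x. x \<in> ?W \<Longrightarrow> (g has_derivative g' x) (at x within ?W)"
    by blast
  have g_eq: "g x = frechet_derivative f (at x) v" if x: "x \<in> ?W" for x
  proof (rule LIMSEQ_unique[OF g(1)[OF x]])
    have "x \<in> ?V"
      using x r by auto
    then have le: "norm (q n x - frechet_derivative f (at x) v) \<le> K * t n" for n
      by (rule q_lim)
    show "(\<lambda>n. q n x) \<longlonglongrightarrow> frechet_derivative f (at x) v"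
    proof (rule LIM_zero_cancel, rule tendsto_norm_zero_cancel, rule tendsto_sandwich[OF _ _ tendsto_const])
      show "(\<lambda>n. K * t n) \<longlonglongrightarrow> 0"
        using tendsto_mult_right_zero[OF t0, of K] by (simp add: mult.commute)
    qed (use le in auto)
  qed
  have x0W: "x0 \<in> ?W"
    using r by simp
  have "(g has_derivative g' x0) (at x0)"
    using g(2)[OF x0W] at_within_open[OF x0W open_ball] by simp
  then have "((\<lambda>x. frechet_derivative f (at x) v) has_derivative g' x0) (at x0)"
    by (rule has_derivative_transform_within_open[OF _ open_ball x0W]) (use g_eq in auto)
  moreover have "g' x0 (c *\<^sub>C h) = c *\<^sub>C g' x0 h" for c h
  proof (rule LIMSEQ_unique[OF q'_lim[OF x0W]])
    have "q' n x0 (c *\<^sub>C h) = c *\<^sub>C q' n x0 h" for n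
      by (rule q'_C) (use r in simp)
    then show "(\<lambda>n. q' n x0 (c *\<^sub>C h)) \<longlonglongrightarrow> c *\<^sub>C g' x0 h"
      using bounded_linear.tendsto[OF bounded_linear_scaleC_right q'_lim[OF x0W]] by simp
  qed
  ultimately show "\<exists>L. ((\<lambda>x. frechet_derivative f (at x) v) has_derivative L) (at x0) \<and>
      (\<forall>c v. L (c *\<^sub>C v) = c *\<^sub>C L v)"
    by blast
qed

lemma holomorphic_map_higher_frechet:
  fixes f :: "'a::complex_banach \<Rightarrow> 'b::complex_banach"
  assumes "holomorphic_map f S"
  shows "holomorphic_map (higher_frechet f vs) S"
  by (induction vs) (simp_all add: assms holomorphic_map_frechet_derivative)

text \<open>
  The link between the iterated Frechet derivatives and ordinary derivatives in one variable.
\<close>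

lemma higher_deriv_slice:
  fixes f :: "'a::complex_banach \<Rightarrow> 'b::complex_banach"
  assumes f: "holomorphic_map f S" and \<phi>: "complex_functional \<phi>" and x: "x + \<zeta> *\<^sub>C w \<in> S"
  shows "(deriv ^^ k) (\<lambda>\<zeta>. \<phi> (f (x + \<zeta> *\<^sub>C w))) \<zeta> =
    \<phi> (higher_frechet f (replicate k w) (x + \<zeta> *\<^sub>C w))"
  using x
proof (induction k arbitrary: \<zeta>)
  case (Suc k)
  let ?g = "\<lambda>\<zeta>. \<phi> (higher_frechet f (replicate k w) (x + \<zeta> *\<^sub>C w))"
  have "\<forall>\<^sub>F \<zeta> in nhds \<zeta>. \<zeta> \<in> {\<zeta>. x + \<zeta> *\<^sub>C w \<in> S}"
    using Suc.prems by (intro eventually_nhds_in_open open_slice holomorphic_map_open[OF f]) auto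
  then have "\<forall>\<^sub>F \<zeta> in nhds \<zeta>. (deriv ^^ k) (\<lambda>\<zeta>. \<phi> (f (x + \<zeta> *\<^sub>C w))) \<zeta> = ?g \<zeta>"
    by eventually_elim (use Suc.IH in auto)
  then have "deriv ((deriv ^^ k) (\<lambda>\<zeta>. \<phi> (f (x + \<zeta> *\<^sub>C w)))) \<zeta> = deriv ?g \<zeta>"
    by (rule deriv_cong_ev) simp
  also have "\<dots> = \<phi> (frechet_derivative (higher_frechet f (replicate k w)) (at (x + \<zeta> *\<^sub>C w)) w)"
    by (intro DERIV_imp_deriv holomorphic_map_slice_derivative[OF holomorphic_map_higher_frechet[OF f] \<phi>] Suc.prems)
  finally show ?case
    by simp
qed simp

unbundle no vec_syntax

section \<open>Schwarz-type estimates in the unit disc\<close>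

text \<open>
  The maximum principle on \<open>\<bar>\<zeta>\<bar> = \<rho>\<close> bounds \<open>h\<close> by \<open>\<rho>\<^sup>-\<^sup>n\<close>, and \<open>\<rho>\<close> may tend to \<open>1\<close>.
\<close>

lemma bounded_cofactor_of_power:
  fixes h :: "complex \<Rightarrow> complex"
  assumes h: "h holomorphic_on ball 0 1"
    and le: "\<And>\<zeta>. cmod \<zeta> < 1 \<Longrightarrow> cmod (\<zeta> ^ n * h \<zeta>) \<le> 1" and \<zeta>: "cmod \<zeta> < 1"
  shows "cmod (h \<zeta>) \<le> 1"
proof -
  have *: "\<rho> ^ n * cmod (h \<zeta>) \<le> 1" if \<rho>: "cmod \<zeta> < \<rho>" "\<rho> < 1" for \<rho>
  proof -
    have pos: "0 < \<rho>"
      using \<rho>(1) norm_ge_zero[of \<zeta>] by linarith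
    have "cmod (h \<zeta>) \<le> 1 / \<rho> ^ n"
    proof (rule maximum_modulus_frontier[of h "ball 0 \<rho>"])
      show "h holomorphic_on interior (ball 0 \<rho>)"
        using \<rho> by (intro holomorphic_on_subset[OF h]) auto
      show "continuous_on (closure (ball 0 \<rho>)) h"
        using \<rho> pos by (intro continuous_on_subset[OF holomorphic_on_imp_continuous_on[OF h]]) auto
      fix w :: complex assume "w \<in> frontier (ball 0 \<rho>)"
      then have "cmod w = \<rho>"
        using pos by simp
      then show "cmod (h w) \<le> 1 / \<rho> ^ n"
        using le[of w] \<rho> pos by (simp add: norm_mult norm_power field_simps)
    qed (use \<rho> in auto)
    then show ?thesis
      using pos by (simp add: field_simps)
  qed
  have "((\<lambda>\<rho>. \<rho> ^ n * cmod (h \<zeta>)) \<longlongrightarrow> 1 ^ n * cmod (h \<zeta>)) (at_left 1)"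
    by (intro tendsto_intros)
  moreover have "\<forall>\<^sub>F \<rho> in at_left 1. \<rho> ^ n * cmod (h \<zeta>) \<le> 1"
    using eventually_at_left_real[OF \<zeta>] by eventually_elim (use * in auto)
  ultimately have "1 ^ n * cmod (h \<zeta>) \<le> 1"
    by (rule tendsto_upperbound) simp
  then show ?thesis
    by simp
qed

lemma power_series_factor:
  assumes g: "\<And>\<zeta>. cmod \<zeta> < 1 \<Longrightarrow> (\<lambda>k. a k * \<zeta> ^ k) sums g \<zeta>"
    and a: "\<And>k. \<lbrakk>0 < k; k < n\<rbrakk> \<Longrightarrow> a k = 0" and n: "0 < n"
  obtains h where "h holomorphic_on ball 0 1"
    "\<And>\<zeta>. cmod \<zeta> < 1 \<Longrightarrow> g \<zeta> = a 0 + \<zeta> ^ n * h \<zeta>" "h 0 = (a n :: complex)"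
proof
  let ?h = "\<lambda>\<zeta>. \<Sum>k. a (k + n) * \<zeta> ^ k"
  have summ: "summable (\<lambda>k. a (k + n) * \<zeta> ^ k)" if "cmod \<zeta> < 1" for \<zeta>
    using summable_powser_ignore_initial_segment[of a n \<zeta>] g[OF that] sums_summable by blast
  show "?h holomorphic_on ball 0 1"
    by (rule power_series_holomorphic[of 0 1 "\<lambda>k. a (k + n)"])
      (use summ in \<open>auto intro: summable_sums\<close>)
  show "?h 0 = a n"
    using powser_zero[of "\<lambda>k. a (k + n)"] by simp
  fix \<zeta> :: complex assume \<zeta>: "cmod \<zeta> < 1"
  have "g \<zeta> = (\<Sum>k. a (k + n) * \<zeta> ^ (k + n)) + (\<Sum>k<n. a k * \<zeta> ^ k)"
    using g[OF \<zeta>] suminf_split_initial_segment[of "\<lambda>k. a k * \<zeta> ^ k" n]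
    by (simp add: sums_iff)
  also have "(\<Sum>k. a (k + n) * \<zeta> ^ (k + n)) = (\<Sum>k. \<zeta> ^ n * (a (k + n) * \<zeta> ^ k))"
    by (simp add: power_add mult_ac)
  also have "\<dots> = \<zeta> ^ n * ?h \<zeta>"
    by (rule suminf_mult[OF summ[OF \<zeta>]])
  also have "(\<Sum>k<n. a k * \<zeta> ^ k) = (\<Sum>k\<in>{0}. a k * \<zeta> ^ k)"
    by (rule sum.mono_neutral_right) (use n a in auto)
  finally show "g \<zeta> = a 0 + \<zeta> ^ n * ?h \<zeta>"
    by simp
qed

lemma Schwarz_lemma_of_order:
  assumes g: "g holomorphic_on ball 0 1" and le: "\<And>\<zeta>. cmod \<zeta> < 1 \<Longrightarrow> cmod (g \<zeta>) \<le> 1"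
    and zero: "\<And>j. j < n \<Longrightarrow> (deriv ^^ j) g 0 = 0" and n: "0 < n" and \<zeta>: "cmod \<zeta> < 1"
  shows "cmod (g \<zeta>) \<le> cmod \<zeta> ^ n"
proof -
  define a where "a k = (deriv ^^ k) g 0 / fact k" for k
  have sums: "(\<lambda>k. a k * \<xi> ^ k) sums g \<xi>" if "cmod \<xi> < 1" for \<xi>
    using holomorphic_power_series[OF g, of \<xi>] that by (simp add: a_def)
  have a: "a k = 0" if "k < n" for k
    using zero[OF that] by (simp add: a_def)
  obtain h where h: "h holomorphic_on ball 0 1"
    "\<And>\<xi>. cmod \<xi> < 1 \<Longrightarrow> g \<xi> = a 0 + \<xi> ^ n * h \<xi>" "h 0 = a n"
    using power_series_factor[OF sums a n] by blast
  have eq: "g \<xi> = \<xi> ^ n * h \<xi>" if "cmod \<xi> < 1" for \<xi>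
    using h(2)[OF that] a[OF n] by simp
  have "cmod (h \<zeta>) \<le> 1"
    by (rule bounded_cofactor_of_power[OF h(1) _ \<zeta>, of n]) (use le in \<open>simp flip: eq\<close>)
  then show ?thesis
    by (simp add: eq[OF \<zeta>] norm_mult norm_power mult_left_le)
qed

lemma pseudo_hyperbolic_le:
  assumes "cmod a \<le> 1" "cmod w \<le> 1"
  shows "cmod (w - a) \<le> cmod (1 - cnj a * w)"
proof -
  have "(cmod (1 - cnj a * w))\<^sup>2 - (cmod (w - a))\<^sup>2 = (1 - (cmod a)\<^sup>2) * (1 - (cmod w)\<^sup>2)"
    unfolding cmod_power2 by (simp add: power2_eq_square algebra_simps)
  also have "\<dots> \<ge> 0"
    using assms by (intro mult_nonneg_nonneg) (auto simp: power_le_one)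
  finally show ?thesis
    by (simp add: power2_le_iff_abs_le)
qed

text \<open>
  Averaging \<open>g\<close> over the rotations by \<open>n\<close>-th roots of unity keeps the bound, the constant term and the
  \<open>n\<close>-th coefficient and removes the coefficients in between. Following the average by the disc
  automorphism that sends \<open>a 0\<close> to \<open>0\<close> produces a bounded function with a zero of order at least \<open>n\<close>; the value of
  its cofactor at \<open>0\<close> is \<open>a n / (1 - \<bar>a 0\<bar>\<^sup>2)\<close>.
\<close>

lemma power_series_coeff_bound_strict:
  assumes g: "\<And>\<zeta>. cmod \<zeta> < 1 \<Longrightarrow> (\<lambda>k. a k * \<zeta> ^ k) sums g \<zeta>"
    and le: "\<And>\<zeta>. cmod \<zeta> < 1 \<Longrightarrow> cmod (g \<zeta>) \<le> 1" and n: "0 < n" and a0: "cmod (a 0) < 1"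
  shows "cmod (a n) \<le> 1 - (cmod (a 0))\<^sup>2"
proof -
  define \<omega> where "\<omega> = exp (2 * of_real pi * \<i> * of_nat 1 / of_nat n)"
  have \<omega>1: "\<omega> ^ k = 1 \<longleftrightarrow> n dvd k" for k
  proof -
    have "\<omega> ^ k = exp (2 * of_real pi * \<i> * of_nat k / of_nat n)"
      by (simp add: \<omega>_def mult_ac flip: exp_of_nat_mult)
    then show ?thesis
      using complex_root_unity_eq_1[of n k] n by simp
  qed
  have \<omega>n: "cmod \<omega> = 1"
    by (simp add: \<omega>_def norm_exp_eq_Re)
  define G where "G \<zeta> = (\<Sum>j<n. g (\<omega> ^ j * \<zeta>)) / n" for \<zeta>
  define b where "b k = a k * ((\<Sum>j<n. (\<omega> ^ k) ^ j) / n)" for k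
  have G: "(\<lambda>k. b k * \<zeta> ^ k) sums G \<zeta>" if "cmod \<zeta> < 1" for \<zeta>
  proof -
    have "(\<lambda>k. (\<Sum>j<n. a k * (\<omega> ^ j * \<zeta>) ^ k) / n) sums G \<zeta>"
      unfolding G_def using that
      by (intro sums_divide sums_sum g) (simp add: norm_mult norm_power \<omega>n)
    also have "(\<lambda>k. (\<Sum>j<n. a k * (\<omega> ^ j * \<zeta>) ^ k) / n) = (\<lambda>k. b k * \<zeta> ^ k)"
    proof
      fix k
      have "(\<Sum>j<n. a k * (\<omega> ^ j * \<zeta>) ^ k) = (\<Sum>j<n. a k * \<zeta> ^ k * (\<omega> ^ k) ^ j)"
        by (intro sum.cong refl) (simp add: power_mult_distrib mult.commute flip: power_mult)
      also have "\<dots> = a k * \<zeta> ^ k * (\<Sum>j<n. (\<omega> ^ k) ^ j)"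
        by (simp only: sum_distrib_left)
      finally show "(\<Sum>j<n. a k * (\<omega> ^ j * \<zeta>) ^ k) / n = b k * \<zeta> ^ k"
        by (simp only: b_def) simp
    qed
    finally show ?thesis .
  qed
  have G_le: "cmod (G \<zeta>) \<le> 1" if "cmod \<zeta> < 1" for \<zeta>
  proof -
    have "cmod (\<Sum>j<n. g (\<omega> ^ j * \<zeta>)) \<le> (\<Sum>j<n. 1)"
      using that by (intro sum_norm_le le) (simp add: norm_mult norm_power \<omega>n)
    then show ?thesis
      using n by (simp add: G_def norm_divide)
  qed
  have b0: "b 0 = a 0" and bn: "b n = a n"
    using \<omega>1[of n] n by (auto simp: b_def)
  have "b k = 0" if "0 < k" "k < n" for k
  proof -
    have "\<omega> ^ k \<noteq> 1"
      using \<omega>1 that by (auto dest: dvd_imp_le)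
    moreover have "(\<omega> ^ k) ^ n = 1"
      using \<omega>1 by (simp flip: power_mult)
    ultimately show ?thesis
      by (simp add: b_def geometric_sum)
  qed
  then obtain h where h: "h holomorphic_on ball 0 1"
    "\<And>\<zeta>. cmod \<zeta> < 1 \<Longrightarrow> G \<zeta> = a 0 + \<zeta> ^ n * h \<zeta>" "h 0 = a n"
    using power_series_factor[of b G n, OF G _ n] b0 bn by auto
  have G_hol: "G holomorphic_on ball 0 1"
    by (rule power_series_holomorphic[of 0 1 b]) (use G in simp)
  have nz: "1 - cnj (a 0) * G \<zeta> \<noteq> 0" if "cmod \<zeta> < 1" for \<zeta>
  proof
    assume "1 - cnj (a 0) * G \<zeta> = 0"
    then have "cmod (a 0) * cmod (G \<zeta>) = 1"
      by (metis complex_mod_cnj norm_mult norm_one right_minus_eq)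
    moreover have "cmod (a 0) * cmod (G \<zeta>) \<le> cmod (a 0) * 1"
      by (rule mult_left_mono[OF G_le[OF that]]) simp
    ultimately show False
      using a0 by simp
  qed
  have "cmod (h 0 / (1 - cnj (a 0) * G 0)) \<le> 1"
  proof (rule bounded_cofactor_of_power[of "\<lambda>\<zeta>. h \<zeta> / (1 - cnj (a 0) * G \<zeta>)" n 0])
    show "(\<lambda>\<zeta>. h \<zeta> / (1 - cnj (a 0) * G \<zeta>)) holomorphic_on ball 0 1"
      using nz by (intro holomorphic_intros h(1) G_hol) auto
    fix \<zeta> :: complex assume \<zeta>: "cmod \<zeta> < 1"
    have "cmod (G \<zeta> - a 0) \<le> cmod (1 - cnj (a 0) * G \<zeta>)"
      by (rule pseudo_hyperbolic_le) (use a0 G_le[OF \<zeta>] in auto)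
    then show "cmod (\<zeta> ^ n * (h \<zeta> / (1 - cnj (a 0) * G \<zeta>))) \<le> 1"
      using nz[OF \<zeta>] h(2)[OF \<zeta>] by (simp add: norm_mult norm_divide)
  qed simp
  moreover have "1 - cnj (a 0) * G 0 = of_real (1 - (cmod (a 0))\<^sup>2)"
    using h(2)[of 0] n complex_norm_square[of "a 0"] by (simp add: mult.commute zero_power)
  ultimately have "cmod (a n) / \<bar>1 - (cmod (a 0))\<^sup>2\<bar> \<le> 1"
    by (simp only: h(3) norm_divide norm_of_real)
  moreover have "0 < 1 - (cmod (a 0))\<^sup>2"
    using a0 by (simp add: power_less_one_iff abs_square_less_1)
  ultimately show ?thesis
    by (simp add: field_simps)
qed

text \<open>
  The case \<open>\<bar>a 0\<bar> = 1\<close>, in which the disc automorphism degenerates, is covered by applying the strict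
  version to \<open>r g\<close> and letting \<open>r\<close> tend to \<open>1\<close>.
\<close>

lemma power_series_coeff_bound:
  assumes g: "\<And>\<zeta>. cmod \<zeta> < 1 \<Longrightarrow> (\<lambda>k. a k * \<zeta> ^ k) sums g \<zeta>"
    and le: "\<And>\<zeta>. cmod \<zeta> < 1 \<Longrightarrow> cmod (g \<zeta>) \<le> 1" and n: "0 < n"
  shows "cmod (a n) \<le> 1 - (cmod (a 0))\<^sup>2"
proof -
  have "g 0 = a 0"
    using g[of 0] powser_sums_zero_iff[of a] by simp
  then have a0: "cmod (a 0) \<le> 1"
    using le[of 0] by simp
  have *: "r * cmod (a n) \<le> 1 - (r * cmod (a 0))\<^sup>2" if r: "0 < r" "r < 1" for r :: real
  proof -
    have "cmod (of_real r * a n) \<le> 1 - (cmod (of_real r * a 0))\<^sup>2"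
    proof (rule power_series_coeff_bound_strict[OF _ _ n])
      show "(\<lambda>k. of_real r * a k * \<zeta> ^ k) sums (of_real r * g \<zeta>)" if "cmod \<zeta> < 1" for \<zeta>
        using sums_mult[OF g[OF that], of "of_real r"] by (simp add: mult_ac)
      show "cmod (of_real r * g \<zeta>) \<le> 1" if "cmod \<zeta> < 1" for \<zeta>
        using le[OF that] r by (simp add: norm_mult mult_le_one)
      show "cmod (of_real r * a 0) < 1"
        using r le_less_trans[OF mult_left_le[OF a0, of r], of 1] by (simp add: norm_mult)
    qed
    then show ?thesis
      using r by (simp add: norm_mult)
  qed
  show ?thesis
  proof (rule tendsto_le[of "at_left (1::real)"])
    show "((\<lambda>r. r * cmod (a n)) \<longlongrightarrow> cmod (a n)) (at_left 1)"
      by (auto intro!: tendsto_eq_intros)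
    show "((\<lambda>r. 1 - (r * cmod (a 0))\<^sup>2) \<longlongrightarrow> 1 - (cmod (a 0))\<^sup>2) (at_left 1)"
      by (auto intro!: tendsto_eq_intros)
    show "\<forall>\<^sub>F r in at_left 1. r * cmod (a n) \<le> 1 - (r * cmod (a 0))\<^sup>2"
      using eventually_at_left_real[OF zero_less_one] by eventually_elim (use * in auto)
  qed simp
qed

text \<open>
  Here \<open>B\<close> is the expansion of the Moebius map \<open>h / (d - c h)\<close>. Multiplying the equation for \<open>B\<close> by \<open>B\<^sup>i\<close>
  gives a Pascal-like recursion \<open>d b(i+1, j+1) = b(i, j) + c b(i+1, j)\<close> for the coefficients
  \<open>b(i, j)\<close> of \<open>h\<^sup>j\<close> in \<open>B\<^sup>i\<close>. Hence each step from \<open>j\<close> to \<open>j + 1\<close> multiplies the sum over \<open>i\<close> by at most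
  \<open>(1 + \<bar>c\<bar>) / \<bar>d\<bar>\<close>.
\<close>

lemma sum_fps_power_coeff_bound:
  fixes B :: "complex fps"
  assumes B: "B * (fps_const d - fps_const c * fps_X) = fps_X" and d: "d \<noteq> 0" and k: "0 < k"
  shows "(\<Sum>i=1..k. cmod ((B ^ i) $ k)) \<le> (1 + cmod c) ^ (k - 1) / cmod d ^ k"
proof -
  have rec0: "d * B $ 0 = 0"
    using arg_cong[OF B, of "\<lambda>F. F $ 0"] by (simp add: mult.commute)
  then have B0: "B $ 0 = 0"
    using d by simp
  have rec: "d * (B ^ Suc i) $ Suc j = (B ^ i) $ j + c * (B ^ Suc i) $ j" for i j
  proof -
    have "B ^ Suc i * (fps_const d - fps_const c * fps_X) = B ^ i * fps_X"
      using B by (simp add: mult_ac)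
    then have "fps_const d * B ^ Suc i = fps_X * B ^ i + fps_const c * (fps_X * B ^ Suc i)"
      by (simp add: algebra_simps)
    then have "(fps_const d * B ^ Suc i) $ Suc j = (fps_X * B ^ i + fps_const c * (fps_X * B ^ Suc i)) $ Suc j"
      by (rule arg_cong)
    then show ?thesis
      by (simp del: power_Suc)
  qed
  have le: "cmod ((B ^ Suc i) $ Suc j) \<le> (cmod ((B ^ i) $ j) + cmod c * cmod ((B ^ Suc i) $ j)) / cmod d" for i j
  proof -
    have "cmod d * cmod ((B ^ Suc i) $ Suc j) = cmod ((B ^ i) $ j + c * (B ^ Suc i) $ j)"
      by (metis norm_mult rec)
    also have "\<dots> \<le> cmod ((B ^ i) $ j) + cmod c * cmod ((B ^ Suc i) $ j)"
      by (metis norm_mult norm_triangle_ineq)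
    finally show ?thesis
      using d by (simp add: field_simps)
  qed
  \<comment> \<open>As \<open>B\<close> has no constant term, the top summand drops out of the recursion.\<close>
  have low: "(B ^ Suc j) $ j = 0" for j
    using startsby_zero_power_prefix[OF B0, of "Suc j"] by (simp del: power_Suc)
  obtain j where "k = Suc j"
    using k by (cases k) auto
  moreover have "(\<Sum>i=1..Suc j. cmod ((B ^ i) $ Suc j)) \<le> (1 + cmod c) ^ j / cmod d ^ Suc j"
  proof (induction j)
    case 0
    show ?case
      using le[of 0 0] B0 by simp
  next
    case (Suc j)
    let ?s = "\<lambda>j. \<Sum>i=1..Suc j. cmod ((B ^ i) $ Suc j)"
    have "?s (Suc j) = (\<Sum>i=0..Suc j. cmod ((B ^ Suc i) $ Suc (Suc j)))"
      using sum.shift_bounds_cl_Suc_ivl[of "\<lambda>i. cmod ((B ^ i) $ Suc (Suc j))" 0 "Suc j"]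
      by (simp del: power_Suc)
    also have "\<dots> \<le> (\<Sum>i=0..Suc j. (cmod ((B ^ i) $ Suc j) + cmod c * cmod ((B ^ Suc i) $ Suc j)) / cmod d)"
      by (rule sum_mono) (rule le)
    also have "\<dots> = ((\<Sum>i=0..Suc j. cmod ((B ^ i) $ Suc j)) + cmod c * (\<Sum>i=0..Suc j. cmod ((B ^ Suc i) $ Suc j))) / cmod d"
      by (simp only: sum_divide_distrib[symmetric] sum.distrib sum_distrib_left)
    also have "(\<Sum>i=0..Suc j. cmod ((B ^ i) $ Suc j)) = ?s j"
      by (subst sum.atLeast_Suc_atMost) simp_all
    also have "(\<Sum>i=0..Suc j. cmod ((B ^ Suc i) $ Suc j)) = (\<Sum>i=0..j. cmod ((B ^ Suc i) $ Suc j))"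
      using low[of "Suc j"] by (simp del: power_Suc)
    also have "\<dots> = ?s j"
      using sum.shift_bounds_cl_Suc_ivl[of "\<lambda>i. cmod ((B ^ i) $ Suc j)" 0 j]
      by (simp del: power_Suc)
    also have "(?s j + cmod c * ?s j) / cmod d = (1 + cmod c) / cmod d * ?s j"
      by (simp add: algebra_simps add_divide_distrib)
    also have "\<dots> \<le> (1 + cmod c) / cmod d * ((1 + cmod c) ^ j / cmod d ^ Suc j)"
      by (rule mult_left_mono[OF Suc.IH]) simp
    finally show ?case
      by simp
  qed
  ultimately show ?thesis
    by simp
qed

text \<open>
  With \<open>T \<zeta> = (\<zeta> + z) / (1 + cnj z * \<zeta>)\<close> and \<open>g = f \<circ> T\<close> one has \<open>f (z + h) = g (h / (d - cnj z * h))\<close> for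
  \<open>d = 1 - \<bar>z\<bar>\<^sup>2\<close>. So the Taylor coefficients of \<open>f\<close> at \<open>z\<close> are combinations of those of \<open>g\<close> at \<open>0\<close>; the
  latter, apart from the constant one, are in modulus at most \<open>1 - \<bar>f z\<bar>\<^sup>2\<close>.
\<close>

theorem Ruscheweyh_higher_deriv_bound:
  assumes f: "f holomorphic_on ball 0 1" and le: "\<And>\<zeta>. cmod \<zeta> < 1 \<Longrightarrow> cmod (f \<zeta>) \<le> 1"
    and z: "cmod z < 1" and k: "0 < k"
  shows "cmod ((deriv ^^ k) f z / fact k) \<le> (1 - (cmod (f z))\<^sup>2) / ((1 - cmod z) ^ k * (1 + cmod z))"
proof -
  define d where "d = complex_of_real (1 - (cmod z)\<^sup>2)"
  have dpos: "0 < 1 - (cmod z)\<^sup>2"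
    using z by (simp add: abs_square_less_1)
  then have d0: "d \<noteq> 0"
    unfolding d_def of_real_eq_0_iff by simp
  define T where "T \<zeta> = (\<zeta> + z) / (1 + cnj z * \<zeta>)" for \<zeta>
  have nz: "1 + cnj z * \<zeta> \<noteq> 0" if "cmod \<zeta> < 1" for \<zeta>
  proof
    assume "1 + cnj z * \<zeta> = 0"
    then have "cmod z * cmod \<zeta> = 1"
      by (metis add_eq_0_iff complex_mod_cnj norm_minus_cancel norm_mult norm_one)
    moreover have "cmod z * cmod \<zeta> < 1"
      using z that mult_strict_mono'[of "cmod z" 1 "cmod \<zeta>" 1] by simp
    ultimately show False by simp
  qed
  have T: "cmod (T \<zeta>) < 1" if "cmod \<zeta> < 1" for \<zeta>
  proof -
    have "(cmod (1 + cnj z * \<zeta>))\<^sup>2 - (cmod (\<zeta> + z))\<^sup>2 = (1 - (cmod z)\<^sup>2) * (1 - (cmod \<zeta>)\<^sup>2)"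
      unfolding cmod_power2 by (simp add: power2_eq_square algebra_simps)
    also have "\<dots> > 0"
      using dpos that by (intro mult_pos_pos) (auto simp: abs_square_less_1)
    finally have "cmod (\<zeta> + z) < cmod (1 + cnj z * \<zeta>)"
      by (simp add: power2_less_imp_less)
    then show ?thesis
      using nz[OF that] by (simp add: T_def norm_divide)
  qed
  define g where "g = f \<circ> T"
  have g_hol: "g holomorphic_on ball 0 1"
    unfolding g_def
  proof (rule holomorphic_on_compose_gen[OF _ f])
    show "T holomorphic_on ball 0 1"
      unfolding T_def using nz by (intro holomorphic_intros) auto
    show "T ` ball 0 1 \<subseteq> ball 0 1"
      using T by auto
  qed
  define G where "G = fps_expansion g 0"
  have G: "g has_fps_expansion G"
    unfolding G_def by (rule has_fps_expansion_fps_expansion[OF open_ball _ g_hol]) simp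
  define a where "a i = (deriv ^^ i) g 0 / fact i" for i
  have Ga: "G $ i = a i" for i
    by (simp add: G_def fps_expansion_def a_def)
  have a0: "a 0 = f z"
    by (simp add: a_def g_def T_def)
  have a_le: "cmod (a i) \<le> 1 - (cmod (f z))\<^sup>2" if "0 < i" for i
  proof -
    have "cmod (a i) \<le> 1 - (cmod (a 0))\<^sup>2"
    proof (rule power_series_coeff_bound[OF _ _ that])
      show "(\<lambda>k. a k * \<zeta> ^ k) sums g \<zeta>" if "cmod \<zeta> < 1" for \<zeta>
        using holomorphic_power_series[OF g_hol, of \<zeta>] that by (simp add: a_def)
      show "cmod (g \<zeta>) \<le> 1" if "cmod \<zeta> < 1" for \<zeta>
        using le[OF T[OF that]] by (simp add: g_def)
    qed
    then show ?thesis by (simp add: a0)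
  qed
  define D where "D = fps_const d - fps_const (cnj z) * fps_X"
  define B where "B = fps_X * inverse D"
  have D0: "D $ 0 \<noteq> 0"
    using d0 by (simp add: D_def)
  have BD: "B * D = fps_X"
    using inverse_mult_eq_1[OF D0] by (simp add: B_def mult.assoc)
  define \<beta> where "\<beta> h = h * inverse (d - cnj z * h)" for h
  have \<beta>: "\<beta> has_fps_expansion B"
    unfolding \<beta>_def B_def D_def by (intro fps_expansion_intros) (use d0 in auto)
  have B0: "B $ 0 = 0"
    by (simp add: B_def)
  have "(g \<circ> \<beta>) has_fps_expansion (G oo B)"
    by (rule has_fps_expansion_compose[OF G \<beta> B0])
  moreover have "\<forall>\<^sub>F h in nhds 0. (g \<circ> \<beta>) h = f (h + z)"
  proof -
    have "((\<lambda>h. d - cnj z * h) \<longlongrightarrow> d - cnj z * 0) (nhds 0)"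
      by (intro tendsto_intros filterlim_ident)
    then have "\<forall>\<^sub>F h in nhds 0. d - cnj z * h \<noteq> 0"
      using d0 by (intro tendsto_imp_eventually_ne[of _ d]) auto
    then show ?thesis
    proof eventually_elim
      case (elim h)
      have dz: "d + z * cnj z = 1"
        using complex_norm_square[of z] by (simp add: d_def)
      have e1: "1 + cnj z * \<beta> h = d / (d - cnj z * h)"
        using elim by (simp add: \<beta>_def field_simps)
      have "\<beta> h + z = (h * (1 - z * cnj z) + z * d) / (d - cnj z * h)"
        using elim by (simp add: \<beta>_def field_simps)
      also have "1 - z * cnj z = d"
        using dz by (simp add: algebra_simps)
      finally have "\<beta> h + z = (h + z) * d / (d - cnj z * h)"
        by (simp add: algebra_simps)
      then show ?case
        using e1 elim d0 by (simp add: g_def T_def)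
    qed
  qed
  ultimately have "(\<lambda>h. f (h + z)) has_fps_expansion (G oo B)"
    by (subst (asm) has_fps_expansion_cong[OF _ refl])
  then have "(G oo B) $ k = (deriv ^^ k) (\<lambda>h. f (h + z)) 0 / fact k"
    by (rule fps_nth_fps_expansion)
  also have "(deriv ^^ k) (\<lambda>h. f (h + z)) 0 = (deriv ^^ k) f z"
    using higher_deriv_shift_0[of k f z] by (simp add: add.commute o_def)
  finally have "(deriv ^^ k) f z / fact k = (\<Sum>i=0..k. a i * (B ^ i) $ k)"
    by (simp add: fps_compose_nth Ga)
  also have "\<dots> = (\<Sum>i=1..k. a i * (B ^ i) $ k)"
    using k by (subst sum.atLeast_Suc_atMost) auto
  also have "cmod \<dots> \<le> (\<Sum>i=1..k. (1 - (cmod (f z))\<^sup>2) * cmod ((B ^ i) $ k))"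
    by (intro sum_norm_le) (auto simp: norm_mult intro!: mult_right_mono a_le)
  also have "\<dots> = (1 - (cmod (f z))\<^sup>2) * (\<Sum>i=1..k. cmod ((B ^ i) $ k))"
    by (simp only: sum_distrib_left)
  also have "\<dots> \<le> (1 - (cmod (f z))\<^sup>2) * ((1 + cmod (cnj z)) ^ (k - 1) / cmod d ^ k)"
  proof (rule mult_left_mono)
    show "(\<Sum>i=1..k. cmod ((B ^ i) $ k)) \<le> (1 + cmod (cnj z)) ^ (k - 1) / cmod d ^ k"
      by (rule sum_fps_power_coeff_bound[OF _ d0 k]) (use BD in \<open>simp add: D_def\<close>)
    show "0 \<le> 1 - (cmod (f z))\<^sup>2"
      using le[OF z] by (simp add: power_le_one)
  qed
  also have "(1 + cmod (cnj z)) ^ (k - 1) / cmod d ^ k = 1 / ((1 - cmod z) ^ k * (1 + cmod z))"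
  proof -
    have "cmod d = (1 - cmod z) * (1 + cmod z)"
      using dpos by (simp only: d_def norm_of_real abs_of_pos) (simp add: power2_eq_square algebra_simps)
    moreover have "(1 + cmod z) ^ k = (1 + cmod z) ^ (k - 1) * (1 + cmod z)"
      using k by (simp flip: power_Suc2)
    moreover have "1 + cmod z \<noteq> 0"
      using norm_ge_zero[of z] by linarith
    ultimately show ?thesis
      by (simp add: power_mult_distrib)
  qed
  finally show ?thesis
    by simp
qed

section \<open>The majorant of the series\<close>

lemma complex_functional_ident: "complex_functional (\<lambda>x::complex. x)"
  by (auto simp: complex_functional_def scaleC_complex_def intro: linearI)

lemma higher_frechet_eq_higher_deriv:
  fixes F :: "'a::complex_banach \<Rightarrow> complex"
  assumes "holomorphic_map F S" "x + \<zeta> *\<^sub>C w \<in> S"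
  shows "higher_frechet F (replicate k w) (x + \<zeta> *\<^sub>C w) = (deriv ^^ k) (\<lambda>\<zeta>. F (x + \<zeta> *\<^sub>C w)) \<zeta>"
  using higher_deriv_slice[OF assms(1) complex_functional_ident assms(2)] by simp

text \<open>
  The one-variable lemma along the line through \<open>z\<close>, after applying a functional that norms \<open>\<mu> z\<close>.
\<close>

lemma schwarz_mapping_order_bound:
  fixes \<mu> :: "'a::complex_banach \<Rightarrow> 'a"
  assumes \<mu>: "schwarz_mapping \<mu>" "zero_of_order \<mu> 0 m" and m: "0 < m" and z: "norm z < 1"
  shows "norm (\<mu> z) \<le> norm z ^ m"
proof (cases "z = 0")
  case True
  then show ?thesis
    using \<mu>(1) by (simp add: schwarz_mapping_def)
next
  case False
  define u where "u = sgn z"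
  have u: "norm u = 1" and zu: "of_real (norm z) *\<^sub>C u = z"
    using False by (auto simp: u_def norm_sgn scaleC_of_real sgn_div_norm)
  obtain \<phi> where \<phi>: "complex_functional \<phi>" "\<phi> (\<mu> z) = of_real (norm (\<mu> z))"
    using complex_norming_functional by blast
  have hol: "holomorphic_map \<mu> (ball 0 1)" and maps: "\<mu> ` ball 0 1 \<subseteq> ball 0 1"
    using \<mu>(1) by (auto simp: schwarz_mapping_def)
  have disc: "0 + \<zeta> *\<^sub>C u \<in> ball 0 1" if "cmod \<zeta> < 1" for \<zeta>
    using that u by (simp add: norm_scaleC)
  have "cmod (\<phi> (\<mu> (0 + of_real (norm z) *\<^sub>C u))) \<le> cmod (of_real (norm z)) ^ m"
  proof (rule Schwarz_lemma_of_order[OF _ _ _ m])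
    show "(\<lambda>\<zeta>. \<phi> (\<mu> (0 + \<zeta> *\<^sub>C u))) holomorphic_on ball 0 1"
      by (rule holomorphic_slice[OF hol \<phi>(1)]) (use disc in auto)
    show "cmod (\<phi> (\<mu> (0 + \<zeta> *\<^sub>C u))) \<le> 1" if "cmod \<zeta> < 1" for \<zeta>
    proof -
      have "cmod (\<phi> (\<mu> (0 + \<zeta> *\<^sub>C u))) \<le> norm (\<mu> (0 + \<zeta> *\<^sub>C u))"
        using \<phi>(1) by (simp add: complex_functional_def)
      also have "\<dots> < 1"
        using subsetD[OF maps imageI[OF disc[OF that]]] by simp
      finally show ?thesis by simp
    qed
    show "(deriv ^^ j) (\<lambda>\<zeta>. \<phi> (\<mu> (0 + \<zeta> *\<^sub>C u))) 0 = 0" if "j < m" for j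
    proof -
      have "higher_frechet \<mu> (replicate j u) 0 = 0"
        using \<mu>(2) that by (simp add: zero_of_order_def)
      then show ?thesis
        using higher_deriv_slice[OF hol \<phi>(1), of 0 0 u j]
          linear_0[OF bounded_linear.linear[OF bounded_linear_complex_functional[OF \<phi>(1)]]]
        by simp
    qed
  qed (use z in simp)
  then show ?thesis
    by (simp add: zu \<phi>(2))
qed

text \<open>
  The slice uses \<open>sgn w\<close>, not \<open>w\<close>, so that it is defined on the unit disc; \<open>sgn 0 = 0\<close> makes the argument
  cover \<open>w = 0\<close> with a constant slice.
\<close>

lemma taylor_term_bound:
  fixes F :: "'a::complex_banach \<Rightarrow> complex"
  assumes F: "holomorphic_map F (ball 0 1)" "F ` ball 0 1 \<subseteq> cball 0 1"
    and w: "norm w < 1" and k: "0 < k"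
  shows "cmod (taylor_term F k w w) \<le>
    (1 - (cmod (F w))\<^sup>2) / (1 + norm w) * (norm w / (1 - norm w)) ^ k"
proof -
  define \<rho> where "\<rho> = norm w"
  have \<rho>0: "0 \<le> \<rho>"
    by (simp add: \<rho>_def)
  define f where "f \<zeta> = F (0 + \<zeta> *\<^sub>C sgn w)" for \<zeta>
  have disc: "0 + \<zeta> *\<^sub>C sgn w \<in> ball 0 1" if "cmod \<zeta> < 1" for \<zeta>
    using that by (simp add: norm_scaleC norm_sgn)
  have f_hol: "f holomorphic_on ball 0 1"
    unfolding f_def by (rule holomorphic_slice[OF F(1) complex_functional_ident]) (use disc in auto)
  have f_le: "cmod (f \<zeta>) \<le> 1" if "cmod \<zeta> < 1" for \<zeta>
    using subsetD[OF F(2) imageI[OF disc[OF that]]] by (simp add: f_def)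
  have w_eq: "\<zeta> *\<^sub>C w = (of_real \<rho> * \<zeta>) *\<^sub>C sgn w" for \<zeta>
  proof -
    have "of_real \<rho> *\<^sub>C sgn w = w"
      by (cases "w = 0") (simp_all add: \<rho>_def scaleC_of_real sgn_div_norm)
    then show ?thesis
      by (metis scaleC_scaleC mult.commute)
  qed
  have fw: "f (of_real \<rho>) = F w"
    using w_eq[of 1] by (simp add: f_def)
  have "higher_frechet F (replicate k w) w = (deriv ^^ k) (\<lambda>\<zeta>. F (0 + \<zeta> *\<^sub>C w)) 1"
    using higher_frechet_eq_higher_deriv[OF F(1), of 0 1 w k] w by simp
  also have "(\<lambda>\<zeta>. F (0 + \<zeta> *\<^sub>C w)) = (\<lambda>\<zeta>. f (of_real \<rho> * \<zeta>))"
    by (simp add: f_def w_eq)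
  also have "(deriv ^^ k) (\<lambda>\<zeta>. f (of_real \<rho> * \<zeta>)) 1 = of_real \<rho> ^ k * (deriv ^^ k) f (of_real \<rho> * 1)"
  proof (rule higher_deriv_compose_linear[OF f_hol _ open_ball])
    show "open ((\<lambda>\<zeta>. of_real \<rho> * \<zeta>) -` ball (0::complex) 1)"
      by (intro open_vimage open_ball continuous_intros)
  qed (use w in \<open>auto simp: \<rho>_def\<close>)
  finally have "cmod (taylor_term F k w w) = \<rho> ^ k * cmod ((deriv ^^ k) f (of_real \<rho>) / fact k)"
    by (simp add: taylor_term_def norm_mult norm_divide norm_power \<rho>_def)
  also have "\<dots> \<le> \<rho> ^ k * ((1 - (cmod (f (of_real \<rho>)))\<^sup>2) /
      ((1 - cmod (of_real \<rho>)) ^ k * (1 + cmod (of_real \<rho>))))"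
    by (intro mult_left_mono Ruscheweyh_higher_deriv_bound[OF f_hol f_le _ k]) (use w in \<open>auto simp: \<rho>_def\<close>)
  also have "\<dots> = (1 - (cmod (F w))\<^sup>2) / (1 + \<rho>) * (\<rho> / (1 - \<rho>)) ^ k"
    using \<rho>0 by (simp add: fw power_divide mult_ac)
  finally show ?thesis
    by (simp only: \<rho>_def)
qed

text \<open>
  In the variable \<open>t = r\<^sup>m\<close> the equation for the critical radius is \<open>bohr_poly N t = 0\<close>.
\<close>

definition bohr_poly :: "nat \<Rightarrow> real \<Rightarrow> real"
  where "bohr_poly N t = t ^ N - (1 - t) ^ (N - 1) * (1 + t) * (1 - 2 * t)"

lemma bohr_poly_strict_mono:
  assumes N: "1 \<le> N" and st: "0 \<le> s" "s < t" "t \<le> 1 / 2"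
  shows "bohr_poly N s < bohr_poly N t"
proof -
  have 1: "s ^ N < t ^ N"
    using st N by (intro power_strict_mono) auto
  have "(1 - t) ^ (N - 1) \<le> (1 - s) ^ (N - 1)"
    using st by (intro power_mono) auto
  moreover have "s * (1 + 2 * s) \<le> t * (1 + 2 * t)"
    using st by (intro mult_mono) auto
  then have "(1 + t) * (1 - 2 * t) \<le> (1 + s) * (1 - 2 * s)"
    by (simp add: algebra_simps)
  ultimately have "(1 - t) ^ (N - 1) * ((1 + t) * (1 - 2 * t)) \<le> (1 - s) ^ (N - 1) * ((1 + s) * (1 - 2 * s))"
    by (rule mult_mono) (use st in auto)
  with 1 show ?thesis
    by (simp add: bohr_poly_def mult.assoc)
qed

lemma bohr_poly_root:
  assumes N: "1 \<le> N"
  obtains t where "0 < t" "t < 1 / 2" "bohr_poly N t = 0"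
proof -
  have 0: "bohr_poly N 0 < 0" and half: "0 < bohr_poly N (1 / 2)"
    using N by (auto simp: bohr_poly_def zero_power)
  have "\<exists>t\<ge>0. t \<le> 1 / 2 \<and> bohr_poly N t = 0"
  proof (rule IVT')
    show "continuous_on {0..1 / 2} (bohr_poly N)"
      unfolding bohr_poly_def by (intro continuous_intros)
  qed (use 0 half in auto)
  then obtain t where t: "0 \<le> t" "t \<le> 1 / 2" "bohr_poly N t = 0"
    by blast
  moreover have "t \<noteq> 0" "t \<noteq> 1 / 2"
    using t(3) 0 half by (metis less_irrefl)+
  ultimately show ?thesis
    using that[of t] by simp
qed

text \<open>
  Dividing by \<open>(1 - t)\<^sup>N\<close> turns the polynomial inequality into the comparison of a geometric tail with
  ratio \<open>t / (1 - t)\<close>.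
\<close>

lemma bohr_poly_sign:
  assumes N: "1 \<le> N" and t: "0 \<le> t" "t < 1 / 2"
  shows "bohr_poly N t \<le> 0 \<longleftrightarrow> (t / (1 - t)) ^ N \<le> (1 - t / (1 - t)) * (1 + t)"
proof -
  have "(1 - t) ^ N = (1 - t) ^ (N - 1) * (1 - t)"
    using N by (simp flip: power_Suc2)
  moreover have "(1 - t / (1 - t)) * (1 - t) = 1 - 2 * t"
    using t by (simp add: field_simps)
  ultimately have "(1 - t) ^ N * ((1 - t / (1 - t)) * (1 + t)) = (1 - t) ^ (N - 1) * (1 + t) * (1 - 2 * t)"
    by (metis (no_types, opaque_lifting) mult.assoc mult.commute)
  moreover have "(1 - t) ^ N * (t / (1 - t)) ^ N = t ^ N"
    using t by (simp flip: power_mult_distrib)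
  moreover have "0 < (1 - t) ^ N"
    using t by simp
  ultimately show ?thesis
    unfolding bohr_poly_def by (metis diff_le_0_iff_le mult_le_cancel_left_pos)
qed

lemma geometric_tail_sums:
  assumes "\<bar>y::real\<bar> < 1"
  shows "(\<lambda>k. c * y ^ (N + k)) sums (c * (y ^ N / (1 - y)))"
proof -
  have "(\<lambda>k. c * y ^ N * y ^ k) sums (c * y ^ N * (1 / (1 - y)))"
    using assms by (intro sums_mult geometric_sums) simp
  then show ?thesis
    by (simp add: power_add mult_ac)
qed

lemma bohr_sum_le_1:
  fixes F :: "'a::complex_banach \<Rightarrow> complex"
  assumes F: "unit_holomorphic F" and N: "1 \<le> N"
    and w: "norm w < 1 / 2" and poly: "bohr_poly N (norm w) \<le> 0"
  shows "bohr_sum N F w \<le> 1"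
proof -
  define \<rho> where "\<rho> = norm w"
  define A where "A = (cmod (F w))\<^sup>2"
  define x where "x = \<rho> / (1 - \<rho>)"
  have \<rho>: "0 \<le> \<rho>" "\<rho> < 1 / 2"
    using w by (auto simp: \<rho>_def)
  then have x: "0 \<le> x" "x < 1"
    by (auto simp: x_def field_simps)
  have hol: "holomorphic_map F (ball 0 1)" and maps: "F ` ball 0 1 \<subseteq> cball 0 1"
    using F by (auto simp: unit_holomorphic_def)
  have "cmod (F w) \<le> 1"
    using subsetD[OF maps imageI[of w]] w by simp
  then have A: "0 \<le> A" "A \<le> 1"
    by (auto simp: A_def power_le_one)
  define b where "b k = (1 - A) / (1 + \<rho>) * x ^ (N + k)" for k
  have b0: "0 \<le> b k" for k
    using A \<rho> x by (simp add: b_def)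
  have "(\<Sum>k. ennreal (cmod (taylor_term F (N + k) w w))) \<le> (\<Sum>k. ennreal (b k))"
  proof (intro suminf_le summableI ennreal_leI)
    fix k
    show "cmod (taylor_term F (N + k) w w) \<le> b k"
      unfolding b_def A_def x_def \<rho>_def
      by (rule taylor_term_bound[OF hol maps]) (use w N in auto)
  qed
  also have "\<dots> = ennreal ((1 - A) / (1 + \<rho>) * (x ^ N / (1 - x)))"
    using b0 unfolding b_def by (rule suminf_ennreal_eq[OF _ geometric_tail_sums]) (use x in simp)
  also have "\<dots> \<le> ennreal (1 - A)"
  proof (rule ennreal_leI)
    have "x ^ N \<le> (1 - x) * (1 + \<rho>)"
      using bohr_poly_sign[OF N \<rho>] poly by (simp add: x_def \<rho>_def)
    then have "x ^ N / ((1 - x) * (1 + \<rho>)) \<le> 1"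
      using x \<rho> by simp
    then have "(1 - A) * (x ^ N / ((1 - x) * (1 + \<rho>))) \<le> 1 - A"
      using A by (intro mult_left_le) auto
    then show "(1 - A) / (1 + \<rho>) * (x ^ N / (1 - x)) \<le> 1 - A"
      by (simp add: mult_ac)
  qed
  finally have "bohr_sum N F w \<le> ennreal A + ennreal (1 - A)"
    unfolding bohr_sum_def A_def by (rule add_left_mono)
  also have "\<dots> = 1"
    using A by (simp flip: ennreal_plus)
  finally show ?thesis .
qed

section \<open>Extremal maps\<close>

text \<open>
  The Taylor expansion at \<open>0\<close> follows from holomorphy: for \<open>norm z < 1\<close> the slice \<open>\<zeta> \<mapsto> F (\<zeta> z)\<close> is
  holomorphic on a disc of radius larger than \<open>1\<close>.
\<close>

lemma unit_holomorphicI: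
  fixes F :: "'a::complex_banach \<Rightarrow> complex"
  assumes F: "holomorphic_map F (ball 0 1)" "F ` ball 0 1 \<subseteq> cball 0 1"
  shows "unit_holomorphic F"
proof -
  have "(\<lambda>s. taylor_term F (Suc s) 0 z) sums (F z - F 0)" if z: "norm z < 1" for z
  proof -
    define R where "R = 2 / (1 + norm z)"
    have R: "1 < R" "R * norm z < 1"
      using z norm_ge_zero[of z] by (auto simp: R_def field_simps simp del: norm_ge_zero)
    define g where "g \<zeta> = F (0 + \<zeta> *\<^sub>C z)" for \<zeta>
    have g: "g holomorphic_on ball 0 R"
      unfolding g_def
    proof (rule holomorphic_slice[OF F(1) complex_functional_ident])
      fix \<zeta> :: complex assume "\<zeta> \<in> ball 0 R"
      then have "cmod \<zeta> * norm z \<le> R * norm z"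
        by (intro mult_right_mono) auto
      then show "0 + \<zeta> *\<^sub>C z \<in> ball 0 1"
        using R by (simp add: norm_scaleC)
    qed
    have "taylor_term F k 0 z = (deriv ^^ k) g 0 / fact k * (1 - 0) ^ k" for k
      using higher_frechet_eq_higher_deriv[OF F(1), of 0 0 z k]
      by (simp add: taylor_term_def g_def[abs_def])
    then have "(\<lambda>k. taylor_term F k 0 z) sums g 1"
      using holomorphic_power_series[OF g, of 1] R by simp
    then have "(\<lambda>k. taylor_term F (Suc k) 0 z) sums (g 1 - taylor_term F 0 0 z)"
      using sums_Suc_iff[of "\<lambda>k. taylor_term F k 0 z" "g 1 - taylor_term F 0 0 z"] by simp
    then show ?thesis
      by (simp add: g_def taylor_term_def)
  qed
  with F show ?thesis
    by (simp add: unit_holomorphic_def)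
qed

lemma holomorphic_map_compose_functional:
  fixes l :: "'a::complex_banach \<Rightarrow> complex"
  assumes l: "complex_functional l" and h: "h holomorphic_on ball 0 1"
  shows "holomorphic_map (\<lambda>x. h (l x)) (ball 0 1)"
proof (rule holomorphic_mapI[where f' = "\<lambda>x v. deriv h (l x) * l v"])
  fix x :: 'a assume x: "x \<in> ball 0 1"
  have "cmod (l x) \<le> norm x"
    using l by (simp add: complex_functional_def)
  then have "l x \<in> ball 0 1"
    using x by simp
  then have "(h has_derivative (*) (deriv h (l x))) (at (l x))"
    using holomorphic_derivI[OF h open_ball] by (simp add: has_field_derivative_def)
  moreover have "(l has_derivative l) (at x)"
    by (rule bounded_linear_imp_has_derivative[OF bounded_linear_complex_functional[OF l]])
  ultimately show "((\<lambda>x. h (l x)) has_derivative (\<lambda>v. deriv h (l x) * l v)) (at x)"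
    using has_derivative_compose by fast
qed (use l in \<open>auto simp: complex_functional_def scaleC_complex_def\<close>)

lemma bounded_bilinear_scaleC:
  "bounded_bilinear (scaleC :: complex \<Rightarrow> 'a \<Rightarrow> 'a::complex_banach)"
proof
  show "\<exists>K. \<forall>c (x::'a). norm (c *\<^sub>C x) \<le> cmod c * norm x * K"
    by (intro exI[of _ 1]) (simp add: norm_scaleC)
qed (auto simp: scaleC_add_left scaleC_add_right linear_scale[OF bounded_linear.linear[OF bounded_linear_scaleC_left]]
    linear_scale[OF bounded_linear.linear[OF bounded_linear_scaleC_right]])

text \<open>
  The shape \<open>c (l x)\<^sup>q x + (l x)\<^sup>q\<^sup>+\<^sup>1 v\<close> is preserved by differentiation in a fixed direction, which lowers
  \<open>q\<close> by one. It covers all derivatives of \<open>x \<mapsto> (l x)\<^sup>p x\<close> up to the order \<open>p\<close>.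
\<close>

lemma has_derivative_functional_power:
  fixes l :: "'a::complex_banach \<Rightarrow> complex"
  assumes l: "complex_functional l"
  shows "((\<lambda>x. (c * l x ^ q) *\<^sub>C x + (l x ^ Suc q) *\<^sub>C v) has_derivative
    (\<lambda>h. (c * of_nat q * l h * l x ^ (q - 1)) *\<^sub>C x +
         (l x ^ q) *\<^sub>C (c *\<^sub>C h + (of_nat (Suc q) * l h) *\<^sub>C v))) (at x)"
proof -
  have l': "(l has_derivative l) (at x)"
    by (rule bounded_linear_imp_has_derivative[OF bounded_linear_complex_functional[OF l]])
  note bilinear = bounded_bilinear.FDERIV[OF bounded_bilinear_scaleC]
  have "((\<lambda>x. (c * l x ^ q) *\<^sub>C x + (l x ^ Suc q) *\<^sub>C v) has_derivative
    (\<lambda>h. ((c * l x ^ q) *\<^sub>C h + (c * (of_nat q * l h * l x ^ (q - 1))) *\<^sub>C x) +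
      ((l x ^ Suc q) *\<^sub>C 0 + (of_nat (Suc q) * l h * l x ^ (Suc q - 1)) *\<^sub>C v))) (at x)"
    by (intro has_derivative_add bilinear has_derivative_mult_right has_derivative_power l'
        has_derivative_ident has_derivative_const)
  also have "(\<lambda>h. ((c * l x ^ q) *\<^sub>C h + (c * (of_nat q * l h * l x ^ (q - 1))) *\<^sub>C x) +
      ((l x ^ Suc q) *\<^sub>C 0 + (of_nat (Suc q) * l h * l x ^ (Suc q - 1)) *\<^sub>C v)) =
    (\<lambda>h. (c * of_nat q * l h * l x ^ (q - 1)) *\<^sub>C x +
         (l x ^ q) *\<^sub>C (c *\<^sub>C h + (of_nat (Suc q) * l h) *\<^sub>C v))"
    by (rule ext) (simp add: scaleC_add_right scaleC_scaleC mult_ac del: of_nat_Suc)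
  finally show ?thesis .
qed

lemma frechet_derivative_functional_power:
  fixes l :: "'a::complex_banach \<Rightarrow> complex"
  assumes l: "complex_functional l"
  shows "frechet_derivative (\<lambda>x. (c * l x ^ Suc q) *\<^sub>C x + (l x ^ Suc (Suc q)) *\<^sub>C v) (at x) h =
    (c * of_nat (Suc q) * l h * l x ^ q) *\<^sub>C x +
    (l x ^ Suc q) *\<^sub>C (c *\<^sub>C h + (of_nat (Suc (Suc q)) * l h) *\<^sub>C v)"
  using fun_cong[OF frechet_derivative_at[OF has_derivative_functional_power[OF l, of c "Suc q" v x]], of h]
  by simp

lemma higher_frechet_functional_power:
  fixes l :: "'a::complex_banach \<Rightarrow> complex"
  assumes l: "complex_functional l" and len: "length vs \<le> p"
  shows "\<exists>c v. higher_frechet (\<lambda>x. (l x ^ p) *\<^sub>C x) vs =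
    (\<lambda>x. (c * l x ^ (p - length vs)) *\<^sub>C x + (l x ^ Suc (p - length vs)) *\<^sub>C v)"
  using len
proof (induction vs)
  case Nil
  show ?case
    by (intro exI[of _ 1] exI[of _ 0]) simp
next
  case (Cons h vs)
  then obtain c v where IH: "higher_frechet (\<lambda>x. (l x ^ p) *\<^sub>C x) vs =
    (\<lambda>x. (c * l x ^ (p - length vs)) *\<^sub>C x + (l x ^ Suc (p - length vs)) *\<^sub>C v)"
    by auto
  define q where "q = p - length (h # vs)"
  have q: "p - length vs = Suc q"
    using Cons.prems by (simp add: q_def)
  have "higher_frechet (\<lambda>x. (l x ^ p) *\<^sub>C x) (h # vs) =
    (\<lambda>x. (c * of_nat (Suc q) * l h * l x ^ q) *\<^sub>C x +
      (l x ^ Suc q) *\<^sub>C (c *\<^sub>C h + (of_nat (Suc (Suc q)) * l h) *\<^sub>C v))"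
    by (simp only: higher_frechet.simps IH q frechet_derivative_functional_power[OF l])
  then show ?case
    unfolding q_def[symmetric] by blast
qed

text \<open>
  In the direction \<open>u\<close> with \<open>l u = 1\<close> the constants stay nonnegative, so that the derivative of order
  \<open>p + 1\<close> cannot vanish by cancellation.
\<close>

lemma higher_frechet_functional_power_replicate:
  fixes l :: "'a::complex_banach \<Rightarrow> complex"
  assumes l: "complex_functional l" and lu: "l u = 1" and j: "j \<le> p"
  shows "\<exists>c d::real. 0 < c \<and> 0 \<le> d \<and> higher_frechet (\<lambda>x. (l x ^ p) *\<^sub>C x) (replicate j u) =
    (\<lambda>x. (of_real c * l x ^ (p - j)) *\<^sub>C x + (l x ^ Suc (p - j)) *\<^sub>C (of_real d *\<^sub>C u))"
  using j
proof (induction j)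
  case 0
  show ?case
    by (intro exI[of _ 1] exI[of _ 0]) simp
next
  case (Suc j)
  then obtain c d :: real where cd: "0 < c" "0 \<le> d" and
    IH: "higher_frechet (\<lambda>x. (l x ^ p) *\<^sub>C x) (replicate j u) =
    (\<lambda>x. (of_real c * l x ^ (p - j)) *\<^sub>C x + (l x ^ Suc (p - j)) *\<^sub>C (of_real d *\<^sub>C u))"
    by auto
  define q where "q = p - Suc j"
  have q: "p - j = Suc q"
    using Suc.prems by (simp add: q_def)
  have "higher_frechet (\<lambda>x. (l x ^ p) *\<^sub>C x) (replicate (Suc j) u) =
    (\<lambda>x. (of_real c * of_nat (Suc q) * l u * l x ^ q) *\<^sub>C x +
      (l x ^ Suc q) *\<^sub>C (of_real c *\<^sub>C u + (of_nat (Suc (Suc q)) * l u) *\<^sub>C (of_real d *\<^sub>C u)))"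
    by (simp only: higher_frechet.simps replicate_Suc IH q frechet_derivative_functional_power[OF l])
  also have "\<dots> = (\<lambda>x. (of_real (c * real (Suc q)) * l x ^ q) *\<^sub>C x +
      (l x ^ Suc q) *\<^sub>C (of_real (c + real (Suc (Suc q)) * d) *\<^sub>C u))"
    by (simp add: lu scaleC_scaleC flip: scaleC_add_left)
  finally have "higher_frechet (\<lambda>x. (l x ^ p) *\<^sub>C x) (replicate (Suc j) u) =
    (\<lambda>x. (of_real (c * real (Suc q)) * l x ^ q) *\<^sub>C x +
      (l x ^ Suc q) *\<^sub>C (of_real (c + real (Suc (Suc q)) * d) *\<^sub>C u))" .
  then show ?case
    unfolding q_def[symmetric] using cd
    by (intro exI[of _ "c * real (Suc q)"] exI[of _ "c + real (Suc (Suc q)) * d"] conjI) auto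
qed

text \<open>
  At \<open>0\<close> the map \<open>c (l x)\<^sup>q x + (l x)\<^sup>q\<^sup>+\<^sup>1 v\<close> vanishes even for \<open>q = 0\<close>, so all derivatives of order at most
  \<open>m - 1\<close> vanish there.
\<close>

lemma functional_power_schwarz:
  fixes l :: "'a::complex_banach \<Rightarrow> complex"
  assumes l: "complex_functional l" and u: "l u = 1" and m: "0 < m"
  shows "schwarz_mapping (\<lambda>x. (l x ^ (m - 1)) *\<^sub>C x)"
    and "zero_of_order (\<lambda>x. (l x ^ (m - 1)) *\<^sub>C x) 0 m"
proof -
  let ?\<mu> = "\<lambda>x. (l x ^ (m - 1)) *\<^sub>C x"
  have lC: "l (c *\<^sub>C v) = c * l v" and l_le: "cmod (l v) \<le> norm v" for c v
    using l by (auto simp: complex_functional_def)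
  have l0: "l 0 = 0"
    using l_le[of 0] by simp
  have "holomorphic_map ?\<mu> (ball 0 1)"
  proof (rule holomorphic_mapI)
    show "(?\<mu> has_derivative (\<lambda>h. (1 * of_nat (m - 1) * l h * l x ^ (m - 1 - 1)) *\<^sub>C x +
         (l x ^ (m - 1)) *\<^sub>C (1 *\<^sub>C h + (of_nat (Suc (m - 1)) * l h) *\<^sub>C 0))) (at x)" for x
      using has_derivative_functional_power[OF l, of 1 "m - 1" 0 x] by simp
  qed (auto simp: lC scaleC_scaleC scaleC_add_right mult_ac)
  moreover have "norm (?\<mu> x) < 1" if "norm x < 1" for x
  proof -
    have "cmod (l x) ^ (m - 1) \<le> 1"
      using l_le[of x] that by (intro power_le_one) auto
    then have "cmod (l x) ^ (m - 1) * norm x \<le> norm x"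
      by (intro mult_left_le_one_le) auto
    with that show ?thesis
      by (simp add: norm_scaleC norm_power)
  qed
  ultimately show "schwarz_mapping ?\<mu>"
    by (auto simp: schwarz_mapping_def)
  have "higher_frechet ?\<mu> vs 0 = 0" if "length vs < m" for vs
  proof -
    have "length vs \<le> m - 1"
      using that by simp
    from higher_frechet_functional_power[OF l this] obtain c v where
      "higher_frechet ?\<mu> vs =
        (\<lambda>x. (c * l x ^ (m - 1 - length vs)) *\<^sub>C x + (l x ^ Suc (m - 1 - length vs)) *\<^sub>C v)"
      by blast
    then show ?thesis
      by (simp only:) (simp add: l0)
  qed
  moreover have "higher_frechet ?\<mu> (replicate m u) 0 \<noteq> 0"
  proof -
    obtain c d :: real where cd: "0 < c" "0 \<le> d" and
      eq: "higher_frechet ?\<mu> (replicate (m - 1) u) =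
        (\<lambda>x. (of_real c * l x ^ 0) *\<^sub>C x + (l x ^ Suc 0) *\<^sub>C (of_real d *\<^sub>C u))"
      using higher_frechet_functional_power_replicate[OF l u order_refl, of "m - 1"] by auto
    have "higher_frechet ?\<mu> (replicate m u) 0 = frechet_derivative (higher_frechet ?\<mu> (replicate (m - 1) u)) (at 0) u"
      using m by (cases m) auto
    also have "\<dots> = of_real c *\<^sub>C u + of_real d *\<^sub>C u"
      unfolding eq
      by (subst frechet_derivative_at[OF has_derivative_functional_power[OF l], symmetric]) (simp add: u)
    also have "\<dots> = (c + d) *\<^sub>R u"
      by (simp add: scaleC_of_real scaleR_add_left)
    finally show ?thesis
      using cd u l0 by auto
  qed
  ultimately show "zero_of_order ?\<mu> 0 m"
    unfolding zero_of_order_def by (intro conjI allI impI exI[of _ "replicate m u"]) simp_all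
qed

lemma higher_deriv_disc_automorphism:
  fixes a t :: real and \<zeta> :: complex
  assumes "1 - of_real (a * t) * \<zeta> \<noteq> 0"
  shows "(deriv ^^ Suc k) (\<lambda>\<zeta>. (of_real a - of_real t * \<zeta>) / (1 - of_real (a * t) * \<zeta>)) \<zeta> =
    - of_real ((1 - a\<^sup>2) * fact (Suc k) * a ^ k * t ^ Suc k) / (1 - of_real (a * t) * \<zeta>) ^ (k + 2)"
  using assms
proof (induction k arbitrary: \<zeta>)
  case 0
  have "((\<lambda>\<zeta>. (of_real a - of_real t * \<zeta>) / (1 - of_real (a * t) * \<zeta>)) has_field_derivative
    - of_real ((1 - a\<^sup>2) * t) / (1 - of_real (a * t) * \<zeta>) ^ 2) (at \<zeta>)"
    using 0 by (auto intro!: derivative_eq_intros simp: power2_eq_square algebra_simps)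
  then show ?case
    by (simp add: DERIV_imp_deriv eval_nat_numeral)
next
  case (Suc k)
  let ?f = "\<lambda>\<zeta>. (of_real a - of_real t * \<zeta>) / (1 - of_real (a * t) * \<zeta>)"
  let ?C = "- of_real ((1 - a\<^sup>2) * fact (Suc k) * a ^ k * t ^ Suc k) :: complex"
  let ?b = "\<lambda>\<zeta>. 1 - of_real (a * t) * \<zeta> :: complex"
  have "((\<lambda>\<zeta>. ?b \<zeta>) \<longlongrightarrow> ?b \<zeta>) (nhds \<zeta>)"
    by (intro tendsto_intros filterlim_ident)
  then have "\<forall>\<^sub>F \<zeta> in nhds \<zeta>. ?b \<zeta> \<noteq> 0"
    using Suc.prems by (rule tendsto_imp_eventually_ne)
  then have "\<forall>\<^sub>F \<zeta> in nhds \<zeta>. (deriv ^^ Suc k) ?f \<zeta> = ?C / ?b \<zeta> ^ (k + 2)"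
    by eventually_elim (rule Suc.IH)
  then have "deriv ((deriv ^^ Suc k) ?f) \<zeta> = deriv (\<lambda>\<zeta>. ?C / ?b \<zeta> ^ (k + 2)) \<zeta>"
    by (rule deriv_cong_ev) simp
  also have "\<dots> = ?C * of_nat (k + 2) * of_real (a * t) / ?b \<zeta> ^ (k + 3)"
  proof (rule DERIV_imp_deriv)
    have b: "(?b has_field_derivative - of_real (a * t)) (at \<zeta>)"
      by (auto intro!: derivative_eq_intros)
    have "((\<lambda>\<zeta>. inverse (?b \<zeta> ^ (k + 2))) has_field_derivative
        - (inverse (?b \<zeta> ^ (k + 2)) * (of_nat (k + 2) * (- of_real (a * t) * ?b \<zeta> ^ (k + 2 - Suc 0))) * inverse (?b \<zeta> ^ (k + 2)))) (at \<zeta>)"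
      by (rule DERIV_inverse'[OF DERIV_power[OF b]]) (use Suc.prems in simp)
    from DERIV_cmult[OF this, of ?C]
    have "((\<lambda>\<zeta>. ?C / ?b \<zeta> ^ (k + 2)) has_field_derivative
        ?C * - (inverse (?b \<zeta> ^ (k + 2)) * (of_nat (k + 2) * (- of_real (a * t) * ?b \<zeta> ^ (k + 2 - Suc 0))) * inverse (?b \<zeta> ^ (k + 2)))) (at \<zeta>)"
      by (simp only: divide_inverse)
    also have "?C * - (inverse (?b \<zeta> ^ (k + 2)) * (of_nat (k + 2) * (- of_real (a * t) * ?b \<zeta> ^ (k + 2 - Suc 0))) * inverse (?b \<zeta> ^ (k + 2)))
        = ?C * of_nat (k + 2) * of_real (a * t) / ?b \<zeta> ^ (k + 3)"
    proof -
      have "inverse (B ^ (k + 2)) * (n * (- s * B ^ (k + 2 - Suc 0))) * inverse (B ^ (k + 2)) = - (n * s / B ^ (k + 3))"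
        if "B \<noteq> 0" for B n s :: complex
        using that by (simp add: field_simps power_add eval_nat_numeral)
      from this[OF Suc.prems] show ?thesis
        by (simp only:) simp
    qed
    finally show "((\<lambda>\<zeta>. ?C / ?b \<zeta> ^ (k + 2)) has_field_derivative ?C * of_nat (k + 2) * of_real (a * t) / ?b \<zeta> ^ (k + 3)) (at \<zeta>)" .
  qed
  also have "?C * of_nat (k + 2) * of_real (a * t) =
      - of_real ((1 - a\<^sup>2) * fact (Suc (Suc k)) * a ^ Suc k * t ^ Suc (Suc k))"
    by (simp add: algebra_simps)
  finally show ?case
    by (simp add: eval_nat_numeral)
qed

text \<open>
  Along \<open>w\<close> the map is \<open>\<zeta> \<mapsto> (a - t \<zeta>) / (1 - a t \<zeta>)\<close>, so that all terms of the sum are explicit and again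
  form a geometric series.
\<close>

lemma bohr_sum_disc_automorphism:
  fixes l :: "'a::complex_banach \<Rightarrow> complex"
  assumes l: "complex_functional l" and a: "0 < a" "a < 1" and t: "0 < t" "t < 1 / 2"
    and w: "norm w < 1" "l w = of_real t" and N: "1 \<le> N"
  defines "F \<equiv> \<lambda>x. (of_real a - l x) / (1 - of_real a * l x)"
  defines "x \<equiv> a * t / (1 - a * t)"
  shows "unit_holomorphic F"
    and "bohr_sum N F w = ennreal (((a - t) / (1 - a * t))\<^sup>2 + (1 - a\<^sup>2) / (a * (1 - a * t)) * (x ^ N / (1 - x)))"
proof -
  have lC: "l (c *\<^sub>C v) = c * l v" and l_le: "cmod (l v) \<le> norm v" for c v
    using l by (auto simp: complex_functional_def)
  have nz: "1 - of_real a * \<zeta> \<noteq> 0" if "cmod \<zeta> < 1" for \<zeta>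
  proof
    assume "1 - of_real a * \<zeta> = 0"
    then have "a * cmod \<zeta> = 1"
      using a by (metis abs_of_pos norm_mult norm_of_real norm_one right_minus_eq)
    moreover have "a * cmod \<zeta> \<le> a * 1"
      using a that by (intro mult_left_mono) auto
    ultimately show False
      using a by simp
  qed
  have hol: "holomorphic_map F (ball 0 1)"
    unfolding F_def
    by (rule holomorphic_map_compose_functional[OF l, of "\<lambda>\<zeta>. (of_real a - \<zeta>) / (1 - of_real a * \<zeta>)"])
      (use nz in \<open>intro holomorphic_intros; simp\<close>)
  moreover have "cmod (F z) \<le> 1" if "norm z < 1" for z
  proof -
    have lz: "cmod (l z) < 1"
      using l_le[of z] that by simp
    then have "cmod (l z - of_real a) \<le> cmod (1 - of_real a * l z)"
      using pseudo_hyperbolic_le[of "of_real a" "l z"] a by simp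
    then show ?thesis
      using nz[OF lz] by (simp add: F_def norm_divide norm_minus_commute)
  qed
  ultimately show "unit_holomorphic F"
    by (intro unit_holomorphicI) auto
  have at: "a * t < 1 / 2" "0 < a * t"
  proof -
    have "a * t \<le> 1 * t"
      using a t by (intro mult_right_mono) auto
    then show "a * t < 1 / 2" using t by linarith
  qed (use a t in simp)
  have x: "0 \<le> x" "x < 1"
    using at by (auto simp: x_def field_simps)
  have Fw: "F w = of_real ((a - t) / (1 - a * t))"
    by (simp add: F_def w(2))
  have b: "cmod (taylor_term F (N + k) w w) = (1 - a\<^sup>2) / (a * (1 - a * t)) * x ^ (N + k)" for k
  proof -
    obtain n where n: "N + k = Suc n"
      using N by (cases "N + k") auto
    have "higher_frechet F (replicate (N + k) w) w = (deriv ^^ (N + k)) (\<lambda>\<zeta>. F (0 + \<zeta> *\<^sub>C w)) 1"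
      using higher_frechet_eq_higher_deriv[OF hol, of 0 1 w "N + k"] w by simp
    also have "(\<lambda>\<zeta>. F (0 + \<zeta> *\<^sub>C w)) = (\<lambda>\<zeta>. (of_real a - of_real t * \<zeta>) / (1 - of_real (a * t) * \<zeta>))"
      by (simp add: F_def lC w(2) mult_ac fun_eq_iff)
    also have "(deriv ^^ (N + k)) \<dots> 1 =
      - of_real ((1 - a\<^sup>2) * fact (Suc n) * a ^ n * t ^ Suc n) / (1 - of_real (a * t) * 1) ^ (n + 2)"
      unfolding n by (rule higher_deriv_disc_automorphism) (use at in \<open>simp flip: of_real_mult add: of_real_eq_1_iff\<close>)
    also have "\<dots> = of_real (- ((1 - a\<^sup>2) * fact (Suc n) * a ^ n * t ^ Suc n) / (1 - a * t) ^ (n + 2))"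
      by simp
    finally have "taylor_term F (N + k) w w = of_real (- ((1 - a\<^sup>2) * fact (Suc n) * a ^ n * t ^ Suc n) / (1 - a * t) ^ (n + 2) / fact (Suc n))"
      by (simp only: taylor_term_def n of_real_divide of_real_fact)
    also have "- ((1 - a\<^sup>2) * fact (Suc n) * a ^ n * t ^ Suc n) / (1 - a * t) ^ (n + 2) / fact (Suc n) =
       - ((1 - a\<^sup>2) * a ^ n * t ^ Suc n / (1 - a * t) ^ (n + 2))"
      by (simp del: fact_Suc)
    also have "(1 - a\<^sup>2) * a ^ n * t ^ Suc n / (1 - a * t) ^ (n + 2) = (1 - a\<^sup>2) / (a * (1 - a * t)) * x ^ Suc n"
      using a at by (simp add: x_def power_divide power_mult_distrib)
    finally have "cmod (taylor_term F (N + k) w w) = \<bar>(1 - a\<^sup>2) / (a * (1 - a * t)) * x ^ Suc n\<bar>"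
      by (simp only: norm_of_real abs_minus)
    also have "\<dots> = (1 - a\<^sup>2) / (a * (1 - a * t)) * x ^ Suc n"
      using a at x by (intro abs_of_nonneg mult_nonneg_nonneg divide_nonneg_nonneg zero_le_power) (auto simp: power_le_one)
    finally show ?thesis
      by (simp only: n)
  qed
  have c0: "0 \<le> (1 - a\<^sup>2) / (a * (1 - a * t))"
    using a at by (auto simp: power_le_one intro!: divide_nonneg_nonneg)
  have "(\<Sum>k. ennreal (cmod (taylor_term F (N + k) w w))) = ennreal ((1 - a\<^sup>2) / (a * (1 - a * t)) * (x ^ N / (1 - x)))"
    unfolding b
  proof (rule suminf_ennreal_eq[OF _ geometric_tail_sums])
    show "0 \<le> (1 - a\<^sup>2) / (a * (1 - a * t)) * x ^ (N + k)" for k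
      using c0 x by (intro mult_nonneg_nonneg zero_le_power)
  qed (use x in simp)
  moreover have "0 \<le> (1 - a\<^sup>2) / (a * (1 - a * t)) * (x ^ N / (1 - x))"
    by (rule mult_nonneg_nonneg[OF c0]) (use x in simp)
  ultimately show "bohr_sum N F w = ennreal (((a - t) / (1 - a * t))\<^sup>2 + (1 - a\<^sup>2) / (a * (1 - a * t)) * (x ^ N / (1 - x)))"
    unfolding bohr_sum_def Fw norm_of_real power2_abs by (simp only: ennreal_plus[OF zero_le_power2])
qed

text \<open>
  After subtracting \<open>1\<close> and cancelling the factor \<open>1 - a\<^sup>2\<close>, which alone tends to \<open>0\<close>, the difference of
  the two sides has the sign of \<open>?g a\<close>. At \<open>a = 1\<close> this is the strict form of \<open>bohr_poly_sign\<close>, and continuity does the rest.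
\<close>

lemma ex_parameter_bohr_sum_gt_1:
  assumes N: "1 \<le> N" and t: "0 < t" "t < 1 / 2" and pos: "0 < bohr_poly N t"
  obtains a where "0 < a" "a < 1"
    "1 < ((a - t) / (1 - a * t))\<^sup>2 + (1 - a\<^sup>2) / (a * (1 - a * t)) *
      ((a * t / (1 - a * t)) ^ N / (1 - a * t / (1 - a * t)))"
proof -
  let ?x = "\<lambda>a. a * t / (1 - a * t)"
  let ?g = "\<lambda>a. ?x a ^ N * (1 - a * t) - a * (1 - ?x a) * (1 - t\<^sup>2)"
  have "(?g \<longlongrightarrow> ?x 1 ^ N * (1 - 1 * t) - 1 * (1 - ?x 1) * (1 - t\<^sup>2)) (at_left 1)"
    using t by (intro tendsto_intros) auto
  moreover have "0 < ?x 1 ^ N * (1 - 1 * t) - 1 * (1 - ?x 1) * (1 - t\<^sup>2)"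
  proof -
    have "(1 - t / (1 - t)) * (1 + t) < (t / (1 - t)) ^ N"
      using bohr_poly_sign[OF N, of t] t pos by simp
    then have "(1 - t / (1 - t)) * (1 + t) * (1 - t) < (t / (1 - t)) ^ N * (1 - t)"
      using t by (intro mult_strict_right_mono) auto
    moreover have "(1 - t / (1 - t)) * (1 + t) * (1 - t) = (1 - t / (1 - t)) * (1 - t\<^sup>2)"
      by (simp only: power2_eq_square) (simp add: algebra_simps)
    ultimately show ?thesis by simp
  qed
  ultimately have "\<forall>\<^sub>F a in at_left 1. 0 < ?g a"
    by (rule order_tendstoD(1))
  then have "\<forall>\<^sub>F a in at_left 1. 0 < ?g a \<and> a \<in> {0<..<1}"
    using eventually_at_left_real[OF zero_less_one] by (rule eventually_conj)
  then obtain a where a: "0 < a" "a < 1" "0 < ?g a"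
    using eventually_happens'[OF trivial_limit_at_left_real] by (metis (no_types, lifting) greaterThanLessThan_iff)
  have at: "a * t < 1 / 2"
  proof -
    have "a * t \<le> 1 * t"
      using a t by (intro mult_right_mono) auto
    then show "a * t < 1 / 2" using t by linarith
  qed
  define x where "x = ?x a"
  define e where "e = 1 - a * t"
  have e: "1 / 2 < e"
    using at by (simp add: e_def)
  have x: "x < 1"
    using at a t by (simp add: x_def field_simps)
  have "(1 - t\<^sup>2) / e\<^sup>2 < x ^ N / (a * e * (1 - x))"
  proof -
    have "a * (1 - x) * (1 - t\<^sup>2) < x ^ N * e"
      using a(3) by (simp add: x_def e_def)
    then have "a * (1 - x) * (1 - t\<^sup>2) / (a * (1 - x) * e\<^sup>2) < x ^ N * e / (a * (1 - x) * e\<^sup>2)"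
      using a e x by (intro divide_strict_right_mono mult_pos_pos) auto
    then show ?thesis
      using a e x by (simp add: power2_eq_square mult_ac)
  qed
  then have "(1 - a\<^sup>2) * ((1 - t\<^sup>2) / e\<^sup>2) < (1 - a\<^sup>2) * (x ^ N / (a * e * (1 - x)))"
    using a by (intro mult_strict_left_mono) (auto simp: abs_square_less_1)
  moreover have "1 - ((a - t) / e)\<^sup>2 = (1 - a\<^sup>2) * ((1 - t\<^sup>2) / e\<^sup>2)"
  proof -
    have "e\<^sup>2 - (a - t)\<^sup>2 = (1 - a\<^sup>2) * (1 - t\<^sup>2)"
      by (simp add: e_def power2_eq_square algebra_simps)
    then show ?thesis
      using e by (simp add: power_divide field_simps)
  qed
  ultimately have "1 < ((a - t) / e)\<^sup>2 + (1 - a\<^sup>2) / (a * e) * (x ^ N / (1 - x))"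
    by simp
  then show ?thesis
    using that[OF a(1,2)] by (simp only: x_def e_def)
qed

section \<open>The critical radius\<close>

theorem theorem3p4:
  fixes m N :: nat
  assumes "m \<ge> 1" and "N \<ge> 1"
  shows "\<exists>R::real. R \<in> {0<..<1} \<and>
    smallest_positive_root
      (\<lambda>r. r ^ (m * N) - (1 - r ^ m) ^ (N - 1) * (1 + r ^ m) * (1 - 2 * r ^ m)) R \<and>
    (\<forall>(F :: 'a::complex_banach \<Rightarrow> complex) \<mu> z.
       unit_holomorphic F \<and> schwarz_mapping \<mu> \<and> zero_of_order \<mu> 0 m \<and>
       z \<in> ball 0 1 \<and> norm z \<le> R \<longrightarrow> bohr_sum N F (\<mu> z) \<le> 1) \<and>
    ((\<exists>x::'a. x \<noteq> 0) \<longrightarrow>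
      (\<forall>R'>R. \<not> (\<forall>(F :: 'a \<Rightarrow> complex) \<mu> z.
         unit_holomorphic F \<and> schwarz_mapping \<mu> \<and> zero_of_order \<mu> 0 m \<and>
         z \<in> ball 0 1 \<and> norm z \<le> R' \<longrightarrow> bohr_sum N F (\<mu> z) \<le> 1)))"
proof -
  have m: "0 < m" and N: "1 \<le> N"
    using assms by auto
  obtain t0 where t0: "0 < t0" "t0 < 1 / 2" "bohr_poly N t0 = 0"
    using bohr_poly_root[OF N] by blast
  define R where "R = root m t0"
  have R: "0 < R" "R ^ m = t0"
    using t0 m by (simp_all add: R_def)
  have "R < 1"
    using t0 m by (simp add: R_def)
  have poly: "r ^ (m * N) - (1 - r ^ m) ^ (N - 1) * (1 + r ^ m) * (1 - 2 * r ^ m) = bohr_poly N (r ^ m)" for r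
    by (simp add: bohr_poly_def power_mult)
  have "R \<le> r" if r: "0 < r" "bohr_poly N (r ^ m) = 0" for r
  proof (rule ccontr)
    assume "\<not> R \<le> r"
    then have "r ^ m < t0"
      using r m R(2) power_strict_mono[of r R m] by simp
    then have "bohr_poly N (r ^ m) < bohr_poly N t0"
      using r t0 by (intro bohr_poly_strict_mono[OF N]) auto
    then show False
      using r t0 by simp
  qed
  then have root: "smallest_positive_root
      (\<lambda>r. r ^ (m * N) - (1 - r ^ m) ^ (N - 1) * (1 + r ^ m) * (1 - 2 * r ^ m)) R"
    unfolding poly smallest_positive_root_def using R t0 by simp
  have le: "bohr_sum N F (\<mu> z) \<le> 1"
    if F: "unit_holomorphic F" and \<mu>: "schwarz_mapping \<mu>" "zero_of_order \<mu> 0 m"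
      and z: "z \<in> ball 0 1" "norm z \<le> R" for F :: "'a \<Rightarrow> complex" and \<mu> z
  proof -
    have "norm (\<mu> z) \<le> norm z ^ m"
      using z by (intro schwarz_mapping_order_bound[OF \<mu> m]) simp
    also have "\<dots> \<le> t0"
      using power_mono[OF z(2) norm_ge_zero, of m] R by simp
    finally have w: "norm (\<mu> z) \<le> t0" .
    then have "bohr_poly N (norm (\<mu> z)) \<le> 0"
      using bohr_poly_strict_mono[OF N norm_ge_zero, of "\<mu> z" t0] t0 by (cases "norm (\<mu> z) = t0") auto
    then show ?thesis
      using w t0 by (intro bohr_sum_le_1[OF F N]) auto
  qed
  have sharp: "\<exists>(F :: 'a \<Rightarrow> complex) \<mu> z. unit_holomorphic F \<and> schwarz_mapping \<mu> \<and> zero_of_order \<mu> 0 m \<and>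
      z \<in> ball 0 1 \<and> norm z \<le> R' \<and> \<not> bohr_sum N F (\<mu> z) \<le> 1"
    if x: "x \<noteq> (0::'a)" and R': "R < R'" for x R'
  proof -
    define u where "u = sgn x"
    have u: "norm u = 1"
      using x by (simp add: u_def norm_sgn)
    obtain l where l: "complex_functional l" "l u = 1"
      using complex_norming_functional[of u] u by (metis of_real_1)
    have "R < root m (1 / 2)"
      unfolding R_def using t0 m by simp
    \<comment> \<open>The bound by \<open>root m (1 / 2)\<close> keeps \<open>t = r\<^sup>m\<close> in the range where the series is a convergent geometric one.\<close>
    then obtain r where r: "R < r" "r < R'" "r < root m (1 / 2)"
      using R' dense[of R "min R' (root m (1 / 2))"] by auto
    define t where "t = r ^ m"
    have r0: "0 < r"
      using R r by linarith
    have t: "t0 < t" "t < 1 / 2"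
      using power_strict_mono[OF r(1), of m] power_strict_mono[OF r(3), of m] R r0 m
      by (auto simp: t_def)
    have "root m (1 / 2) < 1"
      using m by simp
    with r(3) have r1: "r < 1"
      by (rule less_trans)
    have "0 < bohr_poly N t"
      using bohr_poly_strict_mono[OF N, of t0 t] t t0 by simp
    then obtain a where a: "0 < a" "a < 1"
      "1 < ((a - t) / (1 - a * t))\<^sup>2 + (1 - a\<^sup>2) / (a * (1 - a * t)) *
        ((a * t / (1 - a * t)) ^ N / (1 - a * t / (1 - a * t)))"
      using ex_parameter_bohr_sum_gt_1[OF N, of t] t t0 by auto
    let ?F = "\<lambda>x. (of_real a - l x) / (1 - of_real a * l x)"
    let ?\<mu> = "\<lambda>x. (l x ^ (m - 1)) *\<^sub>C x"
    let ?z = "of_real r *\<^sub>C u"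
    have lz: "l ?z = of_real r"
      using l by (simp add: complex_functional_def)
    have \<mu>z: "?\<mu> ?z = of_real t *\<^sub>C u"
      unfolding lz scaleC_scaleC power_minus_mult[OF m] by (simp add: t_def)
    have w: "norm (of_real t *\<^sub>C u) < 1" "l (of_real t *\<^sub>C u) = of_real t"
      using l u t t0 by (auto simp: norm_scaleC complex_functional_def)
    note F = bohr_sum_disc_automorphism[OF l(1) a(1,2) _ t(2) w N]
    have "\<not> bohr_sum N ?F (?\<mu> ?z) \<le> 1"
      unfolding \<mu>z F(2)[OF less_trans[OF t0(1) t(1)]] using a(3) by simp
    moreover have "?z \<in> ball 0 1" "norm ?z \<le> R'"
      using u r r0 r1 by (auto simp: norm_scaleC)
    moreover have "unit_holomorphic ?F"
      by (rule F(1)) (use t t0 in simp)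
    ultimately show ?thesis
      using functional_power_schwarz[OF l m] by blast
  qed
  show ?thesis
  proof (intro exI[of _ R] conjI impI allI root)
    show "R \<in> {0<..<1}"
      using R \<open>R < 1\<close> by simp
  qed (use le sharp in blast)+
qed

end
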